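(* Let $n$ and $c$ be integers with $c\ge 2$ and $n-c+1\ge 4$, and let $G$ be the complement of a forest on $n$ vertices with exactly $c$ components. If $G\ncong\overline{S_{n-c+1}\cup (c-1)K_1}$, then $$\rho(G)\le\rho\left(\overline{D_{n-c+1,1}\cup (c-1)K_1}\right)<\rho\left(\overline{S_{n-c+1}\cup (c-1)K_1}\right),$$ with equality in the first inequality if and only if $\overline{G}\cong D_{n-c+1,1}\cup (c-1)K_1$.
   Context: All graphs are finite and simple. For a connected graph $G$, the distance matrix is $D(G)=(d_G(u,v))_{u,v\in V(G)}$, where $d_G(u,v)$ is the length of a shortest path between $u$ and $v$; the distance spectral radius $\rho(G)$ is the largest eigenvalue of $D(G)$. $\overline{H}$ is the complement of $H$, $\cup$ denotes disjoint union, and $kH$ is the disjoint union of $k$ copies of $H$. $S_k$ is the star on $k$ vertices and $K_1$ is the one-vertex graph. For integers $N\ge 4$ and $a\ge 1$ with $2a\le N-2$, the double star $D_{N,a}$ is the tree on $N$ vertices obtained by adding an edge between the centers of two disjoint stars $S_{a+1}$ and $S_{N-a-1}$ (for $S_2$ either vertex may be taken as center). Thus $D_{N,1}$ is a tree of diameter three with one of its two non-leaf vertices adjacent to exactly one leaf. *)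

theory Defs
  imports "Graph_Theory.Graph_Theory" "Jordan_Normal_Form.Spectral_Radius"
begin

text \<open>
  A finite simple graph is a \<^locale>\<open>pair_graph\<close>: an edge \<open>uv\<close> is represented by
  the two arcs \<open>(u, v)\<close> and \<open>(v, u)\<close>. Its connected components are its strongly connected
  components \<^const>\<open>pre_digraph.sccs\<close>, and graph isomorphism is \<^const>\<open>digraph_iso\<close>.
\<close>

text \<open>
  The predicate \<^const>\<open>forest\<close> of the library is unsuitable here, because it counts the closed walk
  \<open>u, v, u\<close> along a single edge as a cycle. Cycles of a simple graph have length at least 3.
\<close>

definition simple_forest :: "'a pair_pre_digraph \<Rightarrow> bool" where
  "simple_forest F \<longleftrightarrow>
     pair_graph F \<and> \<not> (\<exists>p. pre_digraph.cycle (with_proj F) p \<and> 3 \<le> length p)"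

definition complement :: "'a pair_pre_digraph \<Rightarrow> 'a pair_pre_digraph" where
  "complement H =
     \<lparr>pverts = pverts H,
      parcs = {(u, v). u \<in> pverts H \<and> v \<in> pverts H \<and> u \<noteq> v \<and> (u, v) \<notin> parcs H}\<rparr>"

definition disjoint_union ::
    "'a pair_pre_digraph \<Rightarrow> 'b pair_pre_digraph \<Rightarrow> ('a + 'b) pair_pre_digraph" where
  "disjoint_union G H =
     \<lparr>pverts = pverts G <+> pverts H,
      parcs = map_prod Inl Inl ` parcs G \<union> map_prod Inr Inr ` parcs H\<rparr>"

definition copies :: "nat \<Rightarrow> 'a pair_pre_digraph \<Rightarrow> (nat \<times> 'a) pair_pre_digraph" where
  "copies k H =
     \<lparr>pverts = {..<k} \<times> pverts H,
      parcs = {((i, u), (j, v)). i = j \<and> i < k \<and> (u, v) \<in> parcs H}\<rparr>"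

definition K1 :: "unit pair_pre_digraph" where
  "K1 = \<lparr>pverts = {()}, parcs = {}\<rparr>"

text \<open>The star on \<open>k\<close> vertices; vertex \<open>0\<close> is the center.\<close>

definition star :: "nat \<Rightarrow> nat pair_pre_digraph" where
  "star k = \<lparr>pverts = {..<k}, parcs = {0} \<times> {1..<k} \<union> {1..<k} \<times> {0}\<rparr>"

definition double_star :: "nat \<Rightarrow> nat \<Rightarrow> (nat + nat) pair_pre_digraph" where
  "double_star N a =
     (let S = disjoint_union (star (a + 1)) (star (N - a - 1)) in
       S\<lparr>parcs := parcs S \<union> {(Inl 0, Inr 0), (Inr 0, Inl 0)}\<rparr>)"

text \<open>The value is meaningful only if some path leads from \<open>u\<close> to \<open>v\<close>.\<close>

definition graph_dist :: "'a pair_pre_digraph \<Rightarrow> 'a \<Rightarrow> 'a \<Rightarrow> nat" where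
  "graph_dist G u v =
     (LEAST k. \<exists>p. pre_digraph.apath (with_proj G) u p v \<and> length p = k)"

text \<open>
  Matrices are indexed by natural numbers, so the rows and columns of the distance matrix follow
  an enumeration \<open>vs\<close> of the vertices. Different enumerations give permutation-similar matrices,
  hence the choice made in \<open>dist_spectral_radius\<close> does not affect the spectrum.
\<close>

definition distance_matrix :: "'a pair_pre_digraph \<Rightarrow> 'a list \<Rightarrow> real mat" where
  "distance_matrix G vs =
     mat (length vs) (length vs) (\<lambda>(i, j). real (graph_dist G (vs ! i) (vs ! j)))"

definition dist_spectral_radius :: "'a pair_pre_digraph \<Rightarrow> real" where
  "dist_spectral_radius G =
     Max (spectrum (distance_matrix G (SOME vs. distinct vs \<and> set vs = pverts G)))"

end

theory Submission
  imports Defs "HOL-Analysis.Function_Topology"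
begin

text \<open>
  Since the forest \<open>F\<close> has at least two components, two vertices that are adjacent in \<open>F\<close> have distance
  2 in the complement, and two distinct nonadjacent ones have distance 1. The distance matrix is thus
  \<open>J - I + A\<close>, where \<open>J\<close> is the all-ones matrix and \<open>A\<close> the adjacency matrix of \<open>F\<close> itself, and the
  problem is to maximize the largest eigenvalue of \<open>J + A\<close> over forests with a given number
  \<open>m = n - c\<close> of edges (\<open>dist_spectral_radius_complement\<close>).

  This eigenvalue is the maximum of a Rayleigh quotient, attained at a positive vector \<open>x\<close>. Up to a
  term that does not depend on the edges, the quadratic form of \<open>J + A\<close> at \<open>x\<close> is twice the sum of
  \<open>x u * x v\<close> over the edges \<open>uv\<close>. Root the forest so that a vertex \<open>r\<close> with largest entry is a root.
  Each edge joins a vertex \<open>w\<close> that is not a root to its parent, and replacing the parent by \<open>r\<close> does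
  not decrease the sum; this leads to a star. If \<open>F\<close> is not a star, then some edge \<open>v p(v)\<close> avoids \<open>r\<close>;
  keeping it and moving all others leads to the double star with one leaf at its second center,
  possibly after one more exchange (\<open>top_eig_le_dstar\<close>). The value at \<open>x\<close> has not decreased,
  so neither has the largest eigenvalue. If it is unchanged, then \<open>x\<close> is an eigenvector for both
  graphs with the same eigenvalue, so at every vertex the entries of \<open>x\<close> over the neighbours have
  the same sum in both; as \<open>x\<close> is positive, this forces the two graphs to be equal. A similar exchange
  shows that the double star has a strictly smaller eigenvalue than the star
  (\<open>top_eig_dstar_less_star\<close>).
\<close>

section \<open>The largest eigenvalue of the all-ones matrix plus an adjacency matrix\<close>

definition sq_norm_on :: "'a set \<Rightarrow> ('a \<Rightarrow> real) \<Rightarrow> real" where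
  "sq_norm_on V x = (\<Sum>v\<in>V. (x v)\<^sup>2)"

text \<open>
  The bilinear form of the matrix \<open>J + A\<close> restricted to \<open>V\<close>, where \<open>J\<close> is the all-ones matrix and
  \<open>A\<close> the adjacency matrix of \<open>E\<close>. Vectors are functions on the ambient type, so that graphs on
  the same vertex set can be compared on the same vector without choosing an enumeration.
\<close>

definition bform :: "'a set \<Rightarrow> 'a rel \<Rightarrow> ('a \<Rightarrow> real) \<Rightarrow> ('a \<Rightarrow> real) \<Rightarrow> real" where
  "bform V E x y = (\<Sum>v\<in>V. x v) * (\<Sum>v\<in>V. y v) + (\<Sum>(u, v)\<in>E. x u * y v)"

abbreviation qform :: "'a set \<Rightarrow> 'a rel \<Rightarrow> ('a \<Rightarrow> real) \<Rightarrow> real" where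
  "qform V E x \<equiv> bform V E x x"

definition top_eig :: "'a set \<Rightarrow> 'a rel \<Rightarrow> real" where
  "top_eig V E = (SUP x\<in>{x. sq_norm_on V x = 1}. qform V E x)"

lemma sq_norm_on_nonneg: "0 \<le> sq_norm_on V x"
  by (simp add: sq_norm_on_def sum_nonneg)

locale finite_sym_rel =
  fixes V :: "'a set" and E :: "'a rel"
  assumes fin: "finite V" and ne: "V \<noteq> {}"
    and E_sub: "E \<subseteq> V \<times> V" and symE: "sym E"
begin

lemma finE: "finite E"
  using E_sub fin finite_subset by blast

lemma bform_sym: "bform V E x y = bform V E y x"
proof -
  have "(\<Sum>(u, v)\<in>E. x u * y v) = (\<Sum>(u, v)\<in>E. y u * x v)"
    by (rule sum.reindex_bij_witness[where i = prod.swap and j = prod.swap])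
      (use symE in \<open>auto simp: sym_def\<close>)
  then show ?thesis by (simp add: bform_def)
qed

text \<open>
  Row-wise evaluation: the factor of \<open>x v\<close> is the entry of \<open>(J + A) y\<close> at \<open>v\<close>.
\<close>

lemma bform_eq_sum: "bform V E x y = (\<Sum>v\<in>V. x v * ((\<Sum>u\<in>V. y u) + (\<Sum>u\<in>E `` {v}. y u)))"
proof -
  have "E = Sigma V (\<lambda>v. E `` {v})" using E_sub by auto
  then have "(\<Sum>(u, v)\<in>E. x u * y v) = (\<Sum>(u, v)\<in>Sigma V (\<lambda>v. E `` {v}). x u * y v)" by simp
  also have "\<dots> = (\<Sum>u\<in>V. \<Sum>v\<in>E `` {u}. x u * y v)"
    using fin finE by (intro sum.Sigma[symmetric]) auto
  finally show ?thesis
    by (simp add: bform_def distrib_left sum.distrib sum_distrib_right[symmetric] sum_distrib_left[symmetric])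
qed

lemma qform_shift:
  "qform V E (\<lambda>v. x v + t * y v) = qform V E x + 2 * t * bform V E y x + t\<^sup>2 * qform V E y"
proof -
  have "qform V E (\<lambda>v. x v + t * y v)
      = qform V E x + t * bform V E x y + t * bform V E y x + t\<^sup>2 * qform V E y"
    by (simp add: bform_def sum.distrib sum_distrib_left[symmetric] algebra_simps power2_eq_square
        case_prod_unfold)
  then show ?thesis using bform_sym[of x y] by simp
qed

text \<open>
  A maximizer of the Rayleigh quotient is an eigenvector. Moving from \<open>x\<close> in the direction of the
  unit vector at \<open>v\<close> changes \<open>qform V E - l * sq_norm_on V\<close> by a quadratic polynomial in the step
  length that has no constant term and is never positive; its linear coefficient, which is twice
  the defect of the eigenvalue equation at \<open>v\<close>, must therefore vanish.
\<close>

lemma qform_le_if_attained_imp_eigen: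
  assumes bd: "\<And>y. qform V E y \<le> l * sq_norm_on V y"
    and eq: "qform V E x = l * sq_norm_on V x" and v: "v \<in> V"
  shows "(\<Sum>u\<in>V. x u) + (\<Sum>u\<in>E `` {v}. x u) = l * x v"
proof -
  define e :: "'a \<Rightarrow> real" where "e = (\<lambda>u. if u = v then 1 else 0)"
  define a where "a = bform V E e x - l * x v"
  define b where "b = qform V E e - l"
  have ble: "2 * t * a + t\<^sup>2 * b \<le> 0" for t
  proof -
    have "(\<Sum>u\<in>V. e u * x u) = x v" "(\<Sum>u\<in>V. (e u)\<^sup>2) = 1"
      using v fin by (simp_all add: e_def if_distrib[of "\<lambda>z. z * _"] if_distrib[of "\<lambda>z. z ^ 2"] cong: if_cong)
    moreover have "sq_norm_on V (\<lambda>u. x u + t * e u)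
        = sq_norm_on V x + 2 * t * (\<Sum>u\<in>V. e u * x u) + t\<^sup>2 * (\<Sum>u\<in>V. (e u)\<^sup>2)"
      by (simp add: sq_norm_on_def sum.distrib sum_distrib_left power2_eq_square algebra_simps)
    ultimately have "sq_norm_on V (\<lambda>u. x u + t * e u) = sq_norm_on V x + 2 * t * x v + t\<^sup>2"
      by simp
    then show ?thesis
      using bd[of "\<lambda>u. x u + t * e u"] eq unfolding qform_shift a_def b_def
      by (simp add: algebra_simps)
  qed
  have "a = 0"
  proof (rule ccontr)
    assume "a \<noteq> 0"
    \<comment> \<open>The step \<open>a / k\<close> makes the linear term positive and is short enough for it to dominate.\<close>
    define k where "k = \<bar>b\<bar> + 1"
    have k: "k > 0" "2 * k + b > 0" by (auto simp: k_def)
    have "0 < a\<^sup>2 * (2 * k + b)" using k \<open>a \<noteq> 0\<close> by simp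
    also have "\<dots> = (2 * (a / k) * a + (a / k)\<^sup>2 * b) * k\<^sup>2"
      using k by (simp add: power2_eq_square field_simps)
    also have "\<dots> \<le> 0" using ble[of "a / k"] by (simp add: mult_nonpos_nonneg)
    finally show False by simp
  qed
  moreover have "bform V E e x = (\<Sum>u\<in>V. x u) + (\<Sum>u\<in>E `` {v}. x u)"
    unfolding bform_eq_sum using v fin by (simp add: e_def if_distrib[of "\<lambda>z. z * _"] cong: if_cong)
  ultimately show ?thesis by (simp add: a_def)
qed

text \<open>
  Vectors supported on \<open>V\<close> with entries in \<open>[-1, 1]\<close> form a compact set by Tychonoff's theorem, and
  this set contains all unit vectors supported on \<open>V\<close>. Hence the Rayleigh quotient has a maximum.
\<close>

lemma rayleigh_max_attained:
  obtains x where "sq_norm_on V x = 1" "\<And>y. qform V E y \<le> qform V E x * sq_norm_on V y"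
proof -
  define B :: "'a \<Rightarrow> real set" where "B v = (if v \<in> V then {-1..1} else {0})" for v
  define S where "S = Pi UNIV B \<inter> {x. sq_norm_on V x = 1}"
  have "compactin (product_topology (\<lambda>_. euclidean) UNIV) (Pi UNIV B)"
    using compactin_PiE[of "\<lambda>_. euclidean" UNIV B] by (auto simp: B_def PiE_UNIV_domain)
  then have "compact (Pi UNIV B)" by (simp add: euclidean_product_topology)
  moreover have csq: "continuous_on UNIV (\<lambda>x. sq_norm_on V x)"
    unfolding sq_norm_on_def by (intro continuous_intros) auto
  then have "closed {x :: 'a \<Rightarrow> real. sq_norm_on V x = 1}"
    by (intro closed_Collect_eq) auto
  ultimately have cS: "compact S" unfolding S_def by (rule compact_Int_closed)
  have cq: "continuous_on S (qform V E)"
    unfolding bform_def case_prod_unfold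
    by (intro continuous_intros) (auto intro: continuous_on_subset[OF continuous_on_product_coordinates])
  obtain a where a: "a \<in> V" using ne by auto
  have "(\<lambda>v. if v = a then 1 else 0) \<in> S"
    using a fin by (auto simp: S_def B_def sq_norm_on_def if_distrib[of "\<lambda>z. z ^ 2"] cong: if_cong)
  then have "S \<noteq> {}" by auto
  from continuous_attains_sup[OF cS this cq] obtain x
    where x: "x \<in> S" and max: "\<And>y. y \<in> S \<Longrightarrow> qform V E y \<le> qform V E x" by auto
  have "qform V E y \<le> qform V E x * sq_norm_on V y" for y
  proof (cases "sq_norm_on V y = 0")
    case True
    then have "\<And>v. v \<in> V \<Longrightarrow> y v = 0" using fin by (simp add: sq_norm_on_def sum_nonneg_eq_0_iff)
    then have "qform V E y = 0" by (simp add: bform_eq_sum)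
    then show ?thesis using True by simp
  next
    case False
    define s where "s = sq_norm_on V y"
    have s: "s > 0" using False sq_norm_on_nonneg[of V y] by (simp add: s_def)
    define z where "z = (\<lambda>v. if v \<in> V then y v / sqrt s else 0)"
    have qz: "qform V E z = qform V E y / s"
    proof -
      have "(\<Sum>v\<in>V. z v) = (\<Sum>v\<in>V. y v) / sqrt s"
        by (simp add: z_def sum_divide_distrib)
      moreover have "(\<Sum>(u, v)\<in>E. z u * z v) = (\<Sum>(u, v)\<in>E. y u * y v) / s"
        unfolding sum_divide_distrib
        by (rule sum.cong) (use E_sub s in \<open>auto simp: z_def\<close>)
      ultimately show ?thesis using s by (simp add: bform_def add_divide_distrib)
    qed
    have nz: "sq_norm_on V z = 1"
      using s by (simp add: sq_norm_on_def z_def power_divide sum_divide_distrib[symmetric])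
        (simp add: s_def sq_norm_on_def)
    have "(z v)\<^sup>2 \<le> 1" if "v \<in> V" for v
      using member_le_sum[OF that, of "\<lambda>v. (z v)\<^sup>2"] fin nz by (simp add: sq_norm_on_def)
    then have "z \<in> S" using nz
      by (auto simp: S_def B_def abs_square_le_1 abs_le_iff) (auto simp: z_def)
    then have "qform V E y / s \<le> qform V E x" using max qz by metis
    then show ?thesis using s by (simp add: s_def field_simps)
  qed
  moreover have "sq_norm_on V x = 1" using x by (simp add: S_def)
  ultimately show ?thesis using that by blast
qed

text \<open>
  Why the maximum is attained at a positive vector: the entries of \<open>J + A\<close> are nonnegative, so the
  entrywise absolute value of a maximizer is again a maximizer, and the eigenvalue equation bounds
  each of its entries from below by a positive multiple of the sum of all of them.
\<close>

lemma top_eig_upper: "qform V E y \<le> top_eig V E * sq_norm_on V y"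
  and top_eig_perron:
    "\<exists>x. (\<forall>v\<in>V. x v > 0) \<and> qform V E x = top_eig V E * sq_norm_on V x"
  and top_eig_pos: "top_eig V E > 0"
proof -
  obtain x where x: "sq_norm_on V x = 1"
    and max: "\<And>y. qform V E y \<le> qform V E x * sq_norm_on V y"
    using rayleigh_max_attained by blast
  have top: "top_eig V E = qform V E x" unfolding top_eig_def
  proof (rule cSup_eq_maximum)
    show "qform V E x \<in> qform V E ` {x. sq_norm_on V x = 1}" using x by blast
    show "\<And>q. q \<in> qform V E ` {x. sq_norm_on V x = 1} \<Longrightarrow> q \<le> qform V E x"
      using max by (metis (mono_tags, lifting) imageE mem_Collect_eq mult.right_neutral)
  qed
  show upper: "qform V E y \<le> top_eig V E * sq_norm_on V y" for y using max top by simp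
  have "0 < (card V)^2" using fin ne by (simp add: card_gt_0_iff)
  also have "real ((card V)^2) \<le> qform V E (\<lambda>_. 1)" by (simp add: bform_def power2_eq_square)
  also have "\<dots> \<le> top_eig V E * sq_norm_on V (\<lambda>_. 1)" by (rule upper)
  also have "\<dots> = top_eig V E * card V" by (simp add: sq_norm_on_def)
  finally show pos: "top_eig V E > 0" using fin ne by (simp add: zero_less_mult_iff)
  define y where "y = (\<lambda>v. \<bar>x v\<bar>)"
  have ny: "sq_norm_on V y = 1" using x by (simp add: y_def sq_norm_on_def)
  have "qform V E x \<le> qform V E y"
  proof -
    have "(\<Sum>v\<in>V. x v) * (\<Sum>v\<in>V. x v) \<le> (\<Sum>v\<in>V. y v) * (\<Sum>v\<in>V. y v)"
    proof -
      have "\<bar>\<Sum>v\<in>V. x v\<bar> \<le> (\<Sum>v\<in>V. y v)" unfolding y_def by (rule sum_abs)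
      then have "(\<Sum>v\<in>V. x v)\<^sup>2 \<le> (\<Sum>v\<in>V. y v)\<^sup>2"
        by (metis abs_le_square_iff abs_of_nonneg abs_ge_zero order_trans)
      then show ?thesis by (simp add: power2_eq_square)
    qed
    moreover have "(\<Sum>(u, v)\<in>E. x u * x v) \<le> (\<Sum>(u, v)\<in>E. y u * y v)"
      by (rule sum_mono) (auto simp: y_def abs_mult[symmetric])
    ultimately show ?thesis by (simp add: bform_def)
  qed
  with upper[of y] ny top have eq: "qform V E y = top_eig V E * sq_norm_on V y" by simp
  have "y v > 0" if v: "v \<in> V" for v
  proof -
    have "(\<Sum>u\<in>V. y u) \<noteq> 0"
    proof
      assume "(\<Sum>u\<in>V. y u) = 0"
      then have "\<And>u. u \<in> V \<Longrightarrow> y u = 0" using fin by (simp add: y_def sum_nonneg_eq_0_iff)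
      then show False using ny by (simp add: sq_norm_on_def)
    qed
    then have "0 < (\<Sum>u\<in>V. y u)" by (simp add: y_def sum_nonneg order.not_eq_order_implies_strict)
    also have "\<dots> \<le> (\<Sum>u\<in>V. y u) + (\<Sum>u\<in>E `` {v}. y u)" by (simp add: y_def sum_nonneg)
    also have "\<dots> = top_eig V E * y v"
      by (rule qform_le_if_attained_imp_eigen[OF upper eq v])
    finally show ?thesis using pos by (simp add: zero_less_mult_iff)
  qed
  then show "\<exists>x. (\<forall>v\<in>V. x v > 0) \<and> qform V E x = top_eig V E * sq_norm_on V x"
    using eq by blast
qed

end

section \<open>The distance matrix of the complement\<close>

lemma pverts_complement [simp]: "pverts (complement H) = pverts H"
  by (simp add: complement_def)

lemma in_parcs_complement [simp]:
  "(u, v) \<in> parcs (complement H) \<longleftrightarrow> u \<in> pverts H \<and> v \<in> pverts H \<and> u \<noteq> v \<and> (u, v) \<notin> parcs H"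
  by (simp add: complement_def)

lemma complement_complement:
  assumes "pair_graph H"
  shows "complement (complement H) = H"
proof -
  interpret pair_graph H by fact
  have "parcs (complement (complement H)) = parcs H"
    by (auto dest: in_arcsD1 in_arcsD2 no_loops')
  then show ?thesis by (simp add: complement_def)
qed

lemma finite_sym_rel_pair_graph:
  assumes "pair_graph H" "pverts H \<noteq> {}"
  shows "finite_sym_rel (pverts H) (parcs H)"
proof -
  interpret pair_graph H by fact
  show ?thesis
    using assms(2) by unfold_locales (auto intro: symI in_arcsD1 in_arcsD2 arcs_symmetric)
qed

text \<open>
  If the end points of every edge of \<open>H\<close> have a common neighbour in the complement, then the
  complement has diameter at most 2, and its distance matrix is \<open>J - I + A\<close> with \<open>A\<close> the adjacency
  matrix of \<open>H\<close>.
\<close>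

lemma graph_dist_complement:
  assumes H: "pair_graph H" and uv: "u \<in> pverts H" "v \<in> pverts H"
    and far: "\<And>u v. (u, v) \<in> parcs H \<Longrightarrow>
      \<exists>w\<in>pverts H. w \<noteq> u \<and> w \<noteq> v \<and> (u, w) \<notin> parcs H \<and> (w, v) \<notin> parcs H"
  shows "graph_dist (complement H) u v
    = (if u = v then 0 else if (u, v) \<in> parcs H then 2 else 1)"
proof -
  interpret H: pair_graph H by fact
  interpret C: pair_wf_digraph "complement H"
    by unfold_locales (auto simp: complement_def)
  have len0: "C.apath u p v \<Longrightarrow> length p = 0 \<Longrightarrow> u = v" for p
    by (auto simp: C.apath_Nil_iff)
  have len1: "C.apath u p v \<Longrightarrow> length p = 1 \<Longrightarrow> (u, v) \<notin> parcs H" for p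
    by (auto simp: length_Suc_conv C.apath_Nil_iff C.apath_Cons_iff)
  consider (eq) "u = v" | (adj) "(u, v) \<in> parcs H" "u \<noteq> v" | (nadj) "(u, v) \<notin> parcs H" "u \<noteq> v"
    by blast
  then show ?thesis
  proof cases
    case eq
    have "graph_dist (complement H) u v = 0"
      unfolding graph_dist_def
      by (rule Least_equality) (use eq uv in \<open>auto simp: C.apath_Nil_iff\<close>)
    then show ?thesis using eq by simp
  next
    case adj
    obtain w where w: "w \<in> pverts H" "w \<noteq> u" "w \<noteq> v" "(u, w) \<notin> parcs H" "(w, v) \<notin> parcs H"
      using far adj(1) by blast
    have "C.apath u [(u, w), (w, v)] v"
      using w adj uv by (auto simp: C.apath_Nil_iff C.apath_Cons_iff)
    then have ex: "\<exists>p. C.apath u p v \<and> length p = 2"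
      by (intro exI[of _ "[(u, w), (w, v)]"]) simp
    have low: "2 \<le> k" if k: "\<exists>p. C.apath u p v \<and> length p = k" for k
    proof -
      obtain p where p: "C.apath u p v" "length p = k" using k by blast
      then have "k \<noteq> 0" "k \<noteq> 1" using len0[of p] len1[of p] adj by blast+
      then show "2 \<le> k" by simp
    qed
    have "graph_dist (complement H) u v = 2"
      unfolding graph_dist_def using ex low by (rule Least_equality)
    then show ?thesis using adj by simp
  next
    case nadj
    have "C.apath u [(u, v)] v"
      using nadj uv by (auto simp: C.apath_Nil_iff C.apath_Cons_iff)
    then have ex: "\<exists>p. C.apath u p v \<and> length p = 1"
      by (intro exI[of _ "[(u, v)]"]) simp
    have low: "1 \<le> k" if k: "\<exists>p. C.apath u p v \<and> length p = k" for k
    proof -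
      obtain p where p: "C.apath u p v" "length p = k" using k by blast
      then have "k \<noteq> 0" using len0[of p] nadj by blast
      then show "1 \<le> k" by simp
    qed
    have "graph_dist (complement H) u v = 1"
      unfolding graph_dist_def using ex low by (rule Least_equality)
    then show ?thesis using nadj by simp
  qed
qed

lemma sum_over_enumeration:
  assumes "distinct vs" "set vs = V"
  shows "(\<Sum>i<length vs. f (vs ! i)) = (\<Sum>v\<in>V. f v)"
proof -
  have "bij_betw ((!) vs) {..<length vs} V" using assms by (intro bij_betw_nth) auto
  then show ?thesis by (rule sum.reindex_bij_betw)
qed

text \<open>
  The distance matrix differs from \<open>J + A\<close> by the identity. Every eigenvalue is the Rayleigh quotient
  of an eigenvector, hence at most the maximum, and the positive maximizer is an eigenvector for that
  maximum. In particular the chosen enumeration of the vertices does not affect the value.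
\<close>

lemma dist_spectral_radius_complement:
  assumes H: "pair_graph H" and ne: "pverts H \<noteq> {}"
    and far: "\<And>u v. (u, v) \<in> parcs H \<Longrightarrow>
      \<exists>w\<in>pverts H. w \<noteq> u \<and> w \<noteq> v \<and> (u, w) \<notin> parcs H \<and> (w, v) \<notin> parcs H"
  shows "dist_spectral_radius (complement H) = top_eig (pverts H) (parcs H) - 1"
proof -
  interpret H: pair_graph H by fact
  define V E where "V = pverts H" and "E = parcs H"
  interpret finite_sym_rel V E
    unfolding V_def E_def using finite_sym_rel_pair_graph[OF H ne] .
  define vs where "vs = (SOME vs. distinct vs \<and> set vs = pverts (complement H))"
  have "\<exists>vs. distinct vs \<and> set vs = pverts (complement H)"
    using finite_distinct_list[OF H.pair_finite_verts] by auto
  then have "distinct vs \<and> set vs = pverts (complement H)"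
    unfolding vs_def by (rule someI_ex)
  then have vs: "distinct vs" "set vs = V" by (simp_all add: V_def)
  define N where "N = length vs"
  define D where "D = distance_matrix (complement H) vs"
  have D: "D \<in> carrier_mat N N" by (simp add: D_def distance_matrix_def N_def)
  have inV: "i < N \<Longrightarrow> vs ! i \<in> V" for i using vs by (auto simp: N_def)
  have Dx: "(\<Sum>j<N. D $$ (i, j) * x (vs ! j))
      = (\<Sum>u\<in>V. x u) + (\<Sum>u\<in>E `` {vs ! i}. x u) - x (vs ! i)"
    if i: "i < N" for x and i
  proof -
    let ?v = "vs ! i"
    have "(\<Sum>j<N. D $$ (i, j) * x (vs ! j))
        = (\<Sum>j<N. (if ?v = vs ! j then 0 else if (?v, vs ! j) \<in> E then 2 else 1) * x (vs ! j))"
    proof (rule sum.cong[OF refl])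
      fix j assume j: "j \<in> {..<N}"
      have "graph_dist (complement H) ?v (vs ! j)
          = (if ?v = vs ! j then 0 else if (?v, vs ! j) \<in> parcs H then 2 else 1)"
        by (rule graph_dist_complement[OF H]) (use i j inV far in \<open>auto simp: V_def\<close>)
      then show "D $$ (i, j) * x (vs ! j)
          = (if ?v = vs ! j then 0 else if (?v, vs ! j) \<in> E then 2 else 1) * x (vs ! j)"
        using i j by (auto simp: D_def distance_matrix_def N_def E_def)
    qed
    also have "\<dots> = (\<Sum>u\<in>V. (if ?v = u then 0 else if (?v, u) \<in> E then 2 else 1) * x u)"
      unfolding N_def by (rule sum_over_enumeration[OF vs])
    also have "\<dots> = (\<Sum>u\<in>V. x u + (if u \<in> E `` {?v} then x u else 0) - (if u = ?v then x u else 0))"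
    proof (rule sum.cong[OF refl])
      fix u
      have "(?v, ?v) \<notin> E" using H.no_loops' by (auto simp: E_def)
      then show "(if ?v = u then 0 else if (?v, u) \<in> E then 2 else 1) * x u
          = x u + (if u \<in> E `` {?v} then x u else 0) - (if u = ?v then x u else 0)"
        by (cases "u = ?v") simp_all
    qed
    also have "\<dots> = (\<Sum>u\<in>V. x u) + (\<Sum>u\<in>V. if u \<in> E `` {?v} then x u else 0) - x ?v"
      using fin inV[OF i] by (simp add: sum.distrib sum_subtractf)
    also have "(\<Sum>u\<in>V. if u \<in> E `` {?v} then x u else 0) = (\<Sum>u\<in>E `` {?v}. x u)"
    proof -
      have "V \<inter> {u. u \<in> E `` {?v}} = E `` {?v}" using E_sub by auto
      then show ?thesis by (simp only: sum.If_cases[OF fin] sum.neutral_const add_0_right)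
    qed
    finally show ?thesis .
  qed
  have mv: "(D *\<^sub>v w) $ i = (\<Sum>j<N. D $$ (i, j) * w $ j)" if "w \<in> carrier_vec N" "i < N" for w i
    using that D by (simp add: scalar_prod_def lessThan_atLeast0)
  have fin_spec: "finite (spectrum D)" using card_finite_spectrum(1)[OF D] .
  have "Max (spectrum D) = top_eig V E - 1"
  proof (rule Max_eqI[OF fin_spec])
    fix \<mu> assume "\<mu> \<in> spectrum D"
    then obtain w where w: "w \<in> carrier_vec N" "w \<noteq> 0\<^sub>v N" "D *\<^sub>v w = \<mu> \<cdot>\<^sub>v w"
      using D by (auto simp: spectrum_def eigenvalue_def eigenvector_def)
    \<comment> \<open>Carry the eigenvector over from indices to vertices.\<close>
    define y where "y v = w $ (THE i. i < N \<and> vs ! i = v)" for v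
    have y: "y (vs ! i) = w $ i" if "i < N" for i
    proof -
      have "(THE j. j < N \<and> vs ! j = vs ! i) = i"
        using that vs by (intro the_equality) (auto simp: N_def nth_eq_iff_index_eq)
      then show ?thesis by (simp add: y_def)
    qed
    have eig: "(\<Sum>u\<in>V. y u) + (\<Sum>u\<in>E `` {v}. y u) = (\<mu> + 1) * y v" if v: "v \<in> V" for v
    proof -
      obtain i where i: "i < N" "v = vs ! i" using v vs(2) by (metis N_def in_set_conv_nth)
      have "(\<Sum>j<N. D $$ (i, j) * y (vs ! j)) = \<mu> * y v"
        using mv[OF w(1) i(1)] w i y by simp
      then show ?thesis using Dx[OF i(1), of y] i by (simp add: algebra_simps)
    qed
    have "qform V E y = (\<Sum>v\<in>V. y v * ((\<mu> + 1) * y v))"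
      unfolding bform_eq_sum by (rule sum.cong) (simp_all add: eig)
    also have "\<dots> = (\<mu> + 1) * sq_norm_on V y"
      by (simp add: sq_norm_on_def sum_distrib_left power2_eq_square algebra_simps)
    finally have "(\<mu> + 1) * sq_norm_on V y \<le> top_eig V E * sq_norm_on V y"
      using top_eig_upper[of y] by simp
    moreover have "sq_norm_on V y \<noteq> 0"
    proof
      assume "sq_norm_on V y = 0"
      then have "\<And>v. v \<in> V \<Longrightarrow> y v = 0" using fin by (simp add: sq_norm_on_def sum_nonneg_eq_0_iff)
      then have "w $ i = 0" if "i < N" for i using y[OF that] inV[OF that] by simp
      then have "w = 0\<^sub>v N" using w(1) by (intro eq_vecI) simp_all
      then show False using w(2) by simp
    qed
    then have "sq_norm_on V y > 0" using sq_norm_on_nonneg[of V y] by linarith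
    ultimately show "\<mu> \<le> top_eig V E - 1" by simp
  next
    obtain x where x: "\<forall>v\<in>V. x v > 0" and eq: "qform V E x = top_eig V E * sq_norm_on V x"
      using top_eig_perron by blast
    define w where "w = vec N (\<lambda>i. x (vs ! i))"
    have wc: "w \<in> carrier_vec N" by (simp add: w_def)
    have N0: "N > 0" using vs ne by (auto simp: N_def V_def)
    have "w $ 0 \<noteq> (0\<^sub>v N) $ 0" using N0 x inV[OF N0] by (auto simp: w_def)
    then have "w \<noteq> 0\<^sub>v N" by metis
    moreover have "D *\<^sub>v w = (top_eig V E - 1) \<cdot>\<^sub>v w"
    proof (rule eq_vecI)
      fix i assume "i < dim_vec ((top_eig V E - 1) \<cdot>\<^sub>v w)"
      then have i: "i < N" by (simp add: w_def)
      have "(D *\<^sub>v w) $ i = (\<Sum>j<N. D $$ (i, j) * x (vs ! j))"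
        unfolding mv[OF wc i] by (rule sum.cong) (simp_all add: w_def)
      also have "\<dots> = top_eig V E * x (vs ! i) - x (vs ! i)"
        unfolding Dx[OF i]
        using qform_le_if_attained_imp_eigen[OF top_eig_upper eq inV[OF i]] by simp
      finally show "(D *\<^sub>v w) $ i = ((top_eig V E - 1) \<cdot>\<^sub>v w) $ i"
        using i by (simp add: w_def algebra_simps)
    qed (use D in \<open>simp add: w_def\<close>)
    ultimately show "top_eig V E - 1 \<in> spectrum D"
      using D wc by (auto simp: spectrum_def eigenvalue_def eigenvector_def)
  qed
  then show ?thesis
    by (simp add: dist_spectral_radius_def D_def vs_def V_def E_def)
qed

section \<open>Comparison of forests, stars and double stars\<close>

text \<open>
  The form in which forests enter the argument: \<open>R\<close> is the set of vertices that are not a root, and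
  \<open>p\<close> sends each of them to its parent.
\<close>

definition parent_edges :: "'a set \<Rightarrow> ('a \<Rightarrow> 'a) \<Rightarrow> 'a rel" where
  "parent_edges R p = (\<lambda>w. (w, p w)) ` R \<union> (\<lambda>w. (p w, w)) ` R"

abbreviation star_edges :: "'a set \<Rightarrow> 'a \<Rightarrow> 'a rel" where
  "star_edges R r \<equiv> parent_edges R (\<lambda>_. r)"

text \<open>
  A double star one of whose centers has a single leaf: center \<open>r\<close> is joined to all of \<open>R\<close> except
  \<open>z\<close>, and \<open>z\<close> hangs on the second center \<open>b\<close>. With \<open>card R = m\<close> this is a copy of
  \<open>double_star (m + 1) 1\<close>, up to isolated vertices.
\<close>

abbreviation dstar_edges :: "'a set \<Rightarrow> 'a \<Rightarrow> 'a \<Rightarrow> 'a \<Rightarrow> 'a rel" where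
  "dstar_edges R r b z \<equiv> parent_edges R (\<lambda>w. if w = z then b else r)"

lemma parent_edges_cong:
  "(\<And>w. w \<in> R \<Longrightarrow> p w = q w) \<Longrightarrow> parent_edges R p = parent_edges R q"
  by (auto simp: parent_edges_def image_iff)

lemma parent_edges_Image:
  "parent_edges R p `` {v} = {w \<in> R. p w = v} \<union> (if v \<in> R then {p v} else {})"
  by (auto simp: parent_edges_def)

lemma finite_sym_rel_parent_edges:
  assumes "finite V" "V \<noteq> {}" "R \<subseteq> V" "p ` R \<subseteq> V"
  shows "finite_sym_rel V (parent_edges R p)"
  using assms by unfold_locales (auto simp: parent_edges_def sym_def)

text \<open>
  Excluding cycles of length 2 (and fixed points) of \<open>p\<close> ensures that no edge is listed by both of
  its end points.
\<close>

lemma qform_parent_edges: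
  assumes "finite R" and acyc: "\<And>w. w \<in> R \<Longrightarrow> p w \<in> R \<Longrightarrow> p (p w) \<noteq> w"
  shows "qform V (parent_edges R p) x = (\<Sum>v\<in>V. x v)\<^sup>2 + 2 * (\<Sum>w\<in>R. x w * x (p w))"
proof -
  let ?A = "(\<lambda>w. (w, p w)) ` R" and ?B = "(\<lambda>w. (p w, w)) ` R"
  have "?A \<inter> ?B = {}" using acyc by force
  then have "(\<Sum>(u, v)\<in>?A \<union> ?B. x u * x v) = (\<Sum>(u, v)\<in>?A. x u * x v) + (\<Sum>(u, v)\<in>?B. x u * x v)"
    using assms(1) by (intro sum.union_disjoint) auto
  also have "(\<Sum>(u, v)\<in>?A. x u * x v) = (\<Sum>w\<in>R. x w * x (p w))"
    by (subst sum.reindex) (auto intro: inj_onI)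
  also have "(\<Sum>(u, v)\<in>?B. x u * x v) = (\<Sum>w\<in>R. x w * x (p w))"
    by (subst sum.reindex) (auto intro: inj_onI simp: mult.commute)
  finally show ?thesis by (simp add: bform_def parent_edges_def power2_eq_square)
qed

lemma qform_star_edges:
  assumes "finite R" "r \<notin> R"
  shows "qform V (star_edges R r) x = (\<Sum>v\<in>V. x v)\<^sup>2 + 2 * x r * (\<Sum>w\<in>R. x w)"
proof -
  have "(\<Sum>w\<in>R. x w * x r) = x r * (\<Sum>w\<in>R. x w)"
    by (simp add: sum_distrib_left mult.commute)
  then show ?thesis using assms by (subst qform_parent_edges) auto
qed

lemma qform_dstar_edges:
  assumes "finite R" "r \<notin> R" "b \<in> R" "z \<in> R" "b \<noteq> z"
  shows "qform V (dstar_edges R r b z) x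
    = (\<Sum>v\<in>V. x v)\<^sup>2 + 2 * x r * (\<Sum>w\<in>R - {z}. x w) + 2 * x z * x b"
proof -
  have "(\<Sum>w\<in>R. x w * x (if w = z then b else r)) = x z * x b + (\<Sum>w\<in>R - {z}. x w * x r)"
    using assms by (subst sum.remove[of _ z]) (auto intro!: sum.cong)
  also have "(\<Sum>w\<in>R - {z}. x w * x r) = x r * (\<Sum>w\<in>R - {z}. x w)"
    by (simp add: sum_distrib_left mult.commute)
  finally show ?thesis
    using assms by (subst qform_parent_edges) (auto simp: algebra_simps)
qed

text \<open>
  Comparison principle: two graphs are compared on a maximizer of the first. If the eigenvalues
  agree, that vector is an eigenvector of both matrices for the same eigenvalue; the all-ones part
  cancels, and the two adjacency matrices act in the same way on it.
\<close>

lemma top_eig_mono_at_perron: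
  assumes E: "finite_sym_rel V E" and E': "finite_sym_rel V E'"
    and eq: "qform V E x = top_eig V E * sq_norm_on V x"
    and pos: "\<forall>v\<in>V. x v > 0"
    and le: "qform V E x \<le> qform V E' x"
  shows "top_eig V E \<le> top_eig V E'"
    and "top_eig V E = top_eig V E' \<Longrightarrow> v \<in> V \<Longrightarrow> (\<Sum>u\<in>E `` {v}. x u) = (\<Sum>u\<in>E' `` {v}. x u)"
proof -
  interpret E: finite_sym_rel V E by fact
  interpret E': finite_sym_rel V E' by fact
  have "sq_norm_on V x > 0"
    unfolding sq_norm_on_def using E.fin E.ne pos by (intro sum_pos) (auto simp: less_imp_neq[THEN not_sym])
  moreover have "top_eig V E * sq_norm_on V x \<le> top_eig V E' * sq_norm_on V x"
    using le E'.top_eig_upper[of x] eq by linarith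
  ultimately show "top_eig V E \<le> top_eig V E'" by simp
  assume same: "top_eig V E = top_eig V E'" and v: "v \<in> V"
  have eq': "qform V E' x = top_eig V E' * sq_norm_on V x"
    using le E'.top_eig_upper[of x] eq same by simp
  show "(\<Sum>u\<in>E `` {v}. x u) = (\<Sum>u\<in>E' `` {v}. x u)"
    using E.qform_le_if_attained_imp_eigen[OF E.top_eig_upper eq v]
      E'.qform_le_if_attained_imp_eigen[OF E'.top_eig_upper eq' v] same by simp
qed

lemma sum_pos_subset_eqD:
  fixes x :: "'a \<Rightarrow> real"
  assumes "finite B" "A \<subseteq> B" "\<And>v. v \<in> B \<Longrightarrow> x v > 0" "(\<Sum>v\<in>A. x v) = (\<Sum>v\<in>B. x v)"
  shows "A = B"
proof (rule ccontr)
  assume "A \<noteq> B"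
  then have "0 < (\<Sum>v\<in>B - A. x v)" using assms by (intro sum_pos) auto
  then show False using assms sum_diff[of B A x] by simp
qed

text \<open>
  The heart of the argument. Since \<open>r\<close> maximizes \<open>x\<close>, replacing every parent by \<open>r\<close> never
  decreases the quadratic form. To end at a double star instead of a star, one edge between \<open>v\<close> and \<open>p v \<noteq> r\<close>
  is kept. If \<open>p v\<close> is itself not a root, the result is a double star. Otherwise it is a star
  together with a separate edge, and this is repaired by a further exchange with a leaf \<open>q\<close>: either
  \<open>v\<close> moves from \<open>p v\<close> to \<open>q\<close>, or \<open>p v\<close> takes over the place of \<open>q\<close> next to \<open>r\<close>, whichever does not
  decrease the form.

  If the eigenvalues agree, comparing the two adjacency matrices at \<open>r\<close> shows that already all of
  \<open>R - {v}\<close> had parent \<open>r\<close>, because \<open>x\<close> is positive. In the two repaired cases equality is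
  impossible: the exchange strictly increases the form, or the vertex \<open>p v\<close> has the neighbour \<open>v\<close>
  before it and no neighbour after it.
\<close>

lemma top_eig_le_dstar:
  assumes V: "finite V" "r \<in> V" "R \<subseteq> V - {r}" "p ` R \<subseteq> V"
    and acyc: "\<And>w. w \<in> R \<Longrightarrow> p w \<in> R \<Longrightarrow> p (p w) \<noteq> w"
    and eq: "qform V (parent_edges R p) x = top_eig V (parent_edges R p) * sq_norm_on V x"
    and pos: "\<And>v. v \<in> V \<Longrightarrow> x v > 0" and max: "\<And>v. v \<in> V \<Longrightarrow> x v \<le> x r"
    and card: "2 \<le> card R" and nstar: "\<exists>w\<in>R. p w \<noteq> r"
  shows "\<exists>R' b z. R' \<subseteq> V - {r} \<and> card R' = card R \<and> b \<in> R' \<and> z \<in> R' \<and> b \<noteq> z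
    \<and> top_eig V (parent_edges R p) \<le> top_eig V (dstar_edges R' r b z)
    \<and> (top_eig V (parent_edges R p) = top_eig V (dstar_edges R' r b z)
        \<longrightarrow> parent_edges R p = dstar_edges R' r b z)"
proof -
  \<comment> \<open>The edge that is kept.\<close>
  obtain v where v: "v \<in> R" "p v \<noteq> r" using nstar by blast
  define E where "E = parent_edges R p"
  have pos': "\<forall>v\<in>V. x v > 0" using pos by blast
  have finR: "finite R" using V finite_subset by blast
  have rR: "r \<notin> R" using V by auto
  have inV: "w \<in> V" "p w \<in> V" if "w \<in> R" for w using V that by auto
  have E: "finite_sym_rel V E"
    unfolding E_def using V by (intro finite_sym_rel_parent_edges) auto
  have D: "finite_sym_rel V (dstar_edges R' r b z)" if "R' \<subseteq> V - {r}" "b \<in> R'" for R' b z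
    using V that by (intro finite_sym_rel_parent_edges) auto
  have pv: "p v \<noteq> v" using acyc[of v] v by metis
  have qE: "qform V E x \<le> (\<Sum>v\<in>V. x v)\<^sup>2 + 2 * x r * (\<Sum>w\<in>R - {v}. x w) + 2 * x v * x (p v)"
  proof -
    have "(\<Sum>w\<in>R. x w * x (p w)) = x v * x (p v) + (\<Sum>w\<in>R - {v}. x w * x (p w))"
      using v finR by (simp add: sum.remove)
    also have "(\<Sum>w\<in>R - {v}. x w * x (p w)) \<le> (\<Sum>w\<in>R - {v}. x w * x r)"
      by (intro sum_mono mult_left_mono) (use inV max pos in \<open>auto intro: less_imp_le\<close>)
    also have "\<dots> = x r * (\<Sum>w\<in>R - {v}. x w)"
      by (simp add: sum_distrib_left mult.commute)
    finally show ?thesis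
      unfolding E_def using finR acyc by (subst qform_parent_edges) (auto simp: algebra_simps)
  qed
  have nbrs_r: "E `` {r} = {w \<in> R. p w = r}"
    using rR by (simp add: E_def parent_edges_Image)
  have dnbrs_r: "dstar_edges R' r b z `` {r} = R' - {z}" if "r \<notin> R'" "b \<in> R'" for R' b z
    using that by (auto simp: parent_edges_Image split: if_splits)
  \<comment> \<open>Agreement of the neighbour sums at \<open>r\<close> forces every edge but the kept one to be at \<open>r\<close>.\<close>
  have all_r: "p w = r" if "w \<in> R - {v}"
    and eq_r: "(\<Sum>u\<in>E `` {r}. x u) = (\<Sum>u\<in>dstar_edges R r b v `` {r}. x u)" and "b \<in> R" for b w
  proof -
    have "E `` {r} = R - {v}"
    proof (rule sum_pos_subset_eqD)
      show "E `` {r} \<subseteq> R - {v}" using v nbrs_r by auto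
      show "(\<Sum>u\<in>E `` {r}. x u) = (\<Sum>u\<in>R - {v}. x u)"
        using eq_r dnbrs_r[OF rR \<open>b \<in> R\<close>] by simp
    qed (use finR pos inV in auto)
    then show ?thesis using that(1) nbrs_r by auto
  qed
  show ?thesis
  proof (cases "p v \<in> R")
    case True
    have D': "finite_sym_rel V (dstar_edges R r (p v) v)" using D V True by blast
    have le: "qform V E x \<le> qform V (dstar_edges R r (p v) v) x"
      using qE qform_dstar_edges[OF finR rR True v(1) pv, of V x] by simp
    note cmp = top_eig_mono_at_perron[OF E D' eq[folded E_def] pos' le]
    have "E = dstar_edges R r (p v) v" if "top_eig V E = top_eig V (dstar_edges R r (p v) v)"
      unfolding E_def
    proof (rule parent_edges_cong)
      fix w assume "w \<in> R"
      then show "p w = (if w = v then p v else r)"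
        using all_r[OF _ cmp(2)[OF that V(2)] True, of w] by auto
    qed
    then show ?thesis using V True v pv cmp(1) unfolding E_def by blast
  next
    case False
    obtain q where q: "q \<in> R" "q \<noteq> v"
    proof -
      have "\<not> R \<subseteq> {v}" using card card_mono[of "{v}" R] by auto
      then show thesis using that by blast
    qed
    show ?thesis
    proof (cases "x (p v) \<le> x q")
      case True
      have D': "finite_sym_rel V (dstar_edges R r q v)" using D V q by blast
      have "x v * x (p v) \<le> x v * x q" using True pos[of v] inV v by (intro mult_left_mono) auto
      then have le: "qform V E x \<le> qform V (dstar_edges R r q v) x"
        using qE qform_dstar_edges[OF finR rR q(1) v(1) q(2), of V x] by simp
      note cmp = top_eig_mono_at_perron[OF E D' eq[folded E_def] pos' le]
      have "top_eig V E \<noteq> top_eig V (dstar_edges R r q v)"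
      proof
        assume "top_eig V E = top_eig V (dstar_edges R r q v)"
        from cmp(2)[OF this, of "p v"]
        have "(\<Sum>u\<in>E `` {p v}. x u) = (\<Sum>u\<in>dstar_edges R r q v `` {p v}. x u)" using inV v by blast
        moreover have "dstar_edges R r q v `` {p v} = {}"
          using False v q by (auto simp: parent_edges_Image split: if_splits)
        moreover have "0 < (\<Sum>u\<in>E `` {p v}. x u)"
        proof (rule sum_pos)
          show "finite (E `` {p v})" using finR by (simp add: E_def parent_edges_Image)
          show "E `` {p v} \<noteq> {}" using v by (auto simp: E_def parent_edges_Image)
          show "\<And>u. u \<in> E `` {p v} \<Longrightarrow> 0 < x u"
            using pos inV False by (auto simp: E_def parent_edges_Image)
        qed
        ultimately show False by simp
      qed
      then show ?thesis using V q v cmp(1) unfolding E_def by blast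
    next
      case less: False
      define R' where "R' = insert (p v) (R - {q})"
      have R': "R' \<subseteq> V - {r}" "r \<notin> R'" "finite R'" "p v \<in> R'" "v \<in> R'"
        using V inV v q finR by (auto simp: R'_def)
      have cR': "card R' = card R"
        using False card_Suc_Diff1[OF finR q(1)] finR by (simp add: R'_def)
      have D': "finite_sym_rel V (dstar_edges R' r (p v) v)" using D R' by blast
      have "(\<Sum>w\<in>R - {v}. x w) = x q + (\<Sum>w\<in>R - {v} - {q}. x w)"
        using q finR by (subst sum.remove[of _ q]) auto
      moreover have "R' - {v} - {p v} = R - {v} - {q}" using False pv by (auto simp: R'_def)
      then have "(\<Sum>w\<in>R' - {v}. x w) = x (p v) + (\<Sum>w\<in>R - {v} - {q}. x w)"
        using R' pv by (subst sum.remove[of _ "p v"]) auto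
      ultimately have "(\<Sum>w\<in>R - {v}. x w) < (\<Sum>w\<in>R' - {v}. x w)" using less by simp
      then have "2 * x r * (\<Sum>w\<in>R - {v}. x w) < 2 * x r * (\<Sum>w\<in>R' - {v}. x w)"
        using pos[OF V(2)] by simp
      then have lt: "qform V E x < qform V (dstar_edges R' r (p v) v) x"
        using qE qform_dstar_edges[OF R'(3,2,4,5) pv, of V x] by simp
      note cmp = top_eig_mono_at_perron[OF E D' eq[folded E_def] pos' less_imp_le[OF lt]]
      \<comment> \<open>With equal eigenvalues both matrices would map \<open>x\<close> to the same vector, hence have the
        same value of the form at \<open>x\<close>.\<close>
      interpret E: finite_sym_rel V E by fact
      interpret D': finite_sym_rel V "dstar_edges R' r (p v) v" by fact
      have "top_eig V E \<noteq> top_eig V (dstar_edges R' r (p v) v)"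
      proof
        assume "top_eig V E = top_eig V (dstar_edges R' r (p v) v)"
        then have "qform V E x = qform V (dstar_edges R' r (p v) v) x"
          unfolding E.bform_eq_sum D'.bform_eq_sum by (intro sum.cong) (auto simp: cmp(2))
        then show False using lt by simp
      qed
      then show ?thesis using R' cR' pv cmp(1) unfolding E_def by blast
    qed
  qed
qed

text \<open>
  Hanging the far leaf \<open>z\<close> on \<open>r\<close> gives a star with center \<open>r\<close>; moving the leaves of \<open>r\<close> to \<open>b\<close> gives
  one with center \<open>b\<close>. The center with the larger entry of the positive eigenvector is the right
  choice. The other center then loses a neighbour, so that its two neighbour sums differ and
  equality is excluded. The bound on \<open>card R\<close> is what gives \<open>r\<close> a leaf in the second case.
\<close>

lemma top_eig_dstar_less_star:
  assumes V: "finite V" "r \<in> V" "R \<subseteq> V - {r}" and R: "b \<in> R" "z \<in> R" "b \<noteq> z" and card: "3 \<le> card R"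
  shows "\<exists>R' r'. r' \<in> V \<and> R' \<subseteq> V - {r'} \<and> card R' = card R
    \<and> top_eig V (dstar_edges R r b z) < top_eig V (star_edges R' r')"
proof -
  define D where "D = dstar_edges R r b z"
  have finR: "finite R" and rR: "r \<notin> R" using V finite_subset by blast+
  have Dl: "finite_sym_rel V D"
    unfolding D_def using V R by (intro finite_sym_rel_parent_edges) auto
  interpret D: finite_sym_rel V D by fact
  obtain x where pos: "\<And>v. v \<in> V \<Longrightarrow> x v > 0" and eq: "qform V D x = top_eig V D * sq_norm_on V x"
    using D.top_eig_perron by blast
  have pos': "\<forall>v\<in>V. x v > 0" using pos by blast
  have bz: "b \<in> V" "z \<in> V" using V R by auto
  define L where "L = R - {b, z}"
  have finL: "finite L" and LV: "L \<subseteq> V" using finR V by (auto simp: L_def)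
  have sumR: "(\<Sum>w\<in>R. x w) = x b + x z + (\<Sum>w\<in>L. x w)" for x :: "'a \<Rightarrow> real"
  proof -
    have "(\<Sum>w\<in>R. x w) = x b + (\<Sum>w\<in>R - {b}. x w)" using R finR by (simp add: sum.remove)
    also have "(\<Sum>w\<in>R - {b}. x w) = x z + (\<Sum>w\<in>R - {b} - {z}. x w)"
      using R finR by (subst sum.remove[of _ z]) auto
    also have "R - {b} - {z} = L" by (auto simp: L_def)
    finally show ?thesis by simp
  qed
  have sumRz: "(\<Sum>w\<in>R - {z}. x w) = x b + (\<Sum>w\<in>L. x w)"
    using sumR[of x] R finR by (simp add: sum_diff1)
  have qD: "qform V D x = (\<Sum>v\<in>V. x v)\<^sup>2 + 2 * x r * (x b + (\<Sum>w\<in>L. x w)) + 2 * x z * x b"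
    unfolding D_def using R finR rR by (simp add: qform_dstar_edges sumRz)
  have D_b: "D `` {b} = {z, r}" and D_r: "D `` {r} = R - {z}"
    using R rR by (auto simp: D_def parent_edges_Image split: if_splits)
  show ?thesis
  proof (cases "x b \<le> x r")
    case True
    have S: "finite_sym_rel V (star_edges R r)"
      using V by (intro finite_sym_rel_parent_edges) auto
    have "x z * x b \<le> x z * x r" using True pos bz by (intro mult_left_mono) (auto intro: less_imp_le)
    then have le: "qform V D x \<le> qform V (star_edges R r) x"
      using finR rR by (simp add: qD qform_star_edges sumR algebra_simps)
    note cmp = top_eig_mono_at_perron[OF Dl S eq pos' le]
    have "top_eig V D \<noteq> top_eig V (star_edges R r)"
    proof
      assume same: "top_eig V D = top_eig V (star_edges R r)"
      have "z \<noteq> r" using R rR by auto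
      have nbr: "star_edges R r `` {b} = {r}"
        using R rR by (auto simp: parent_edges_Image split: if_splits)
      from cmp(2)[OF same bz(1)] have "x z + x r = x r"
        using \<open>z \<noteq> r\<close> by (simp add: D_b nbr)
      then show False using pos[OF bz(2)] by simp
    qed
    then have "top_eig V (dstar_edges R r b z) < top_eig V (star_edges R r)"
      using cmp(1) by (simp add: D_def)
    then show ?thesis using V by blast
  next
    case False
    define R' where "R' = insert r (R - {b})"
    have R': "b \<notin> R'" "R' \<subseteq> V - {b}" "finite R'" using V R rR finR by (auto simp: R'_def)
    have cR': "card R' = card R" using rR card_Suc_Diff1[OF finR R(1)] finR by (simp add: R'_def)
    have sumR': "(\<Sum>w\<in>R'. x w) = x r + x z + (\<Sum>w\<in>L. x w)"
      using sumR[of x] R rR finR by (simp add: R'_def sum_diff1)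
    have S: "finite_sym_rel V (star_edges R' b)"
      using V R' bz by (intro finite_sym_rel_parent_edges) auto
    have "x r * (\<Sum>w\<in>L. x w) \<le> x b * (\<Sum>w\<in>L. x w)"
      using False pos LV by (intro mult_right_mono sum_nonneg) (auto intro: less_imp_le)
    then have le: "qform V D x \<le> qform V (star_edges R' b) x"
      using R' by (simp add: qD qform_star_edges sumR' algebra_simps)
    note cmp = top_eig_mono_at_perron[OF Dl S eq pos' le]
    have "top_eig V D \<noteq> top_eig V (star_edges R' b)"
    proof
      assume same: "top_eig V D = top_eig V (star_edges R' b)"
      have "star_edges R' b `` {r} = {b}"
        using R' by (auto simp: parent_edges_Image R'_def)
      with cmp(2)[OF same V(2)] have "x b + (\<Sum>w\<in>L. x w) = x b"
        by (simp add: D_r sumRz)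
      moreover have "L \<noteq> {}"
      proof
        assume "L = {}"
        then have "R \<subseteq> {b, z}" by (auto simp: L_def)
        from card_mono[OF _ this] card R show False by simp
      qed
      then have "0 < (\<Sum>w\<in>L. x w)" using finL LV pos by (intro sum_pos) auto
      ultimately show False by simp
    qed
    then have "top_eig V (dstar_edges R r b z) < top_eig V (star_edges R' b)"
      using cmp(1) by (simp add: D_def)
    then show ?thesis using bz R' cR' by blast
  qed
qed

section \<open>Isomorphic graphs\<close>

lemma top_eig_iso:
  assumes f: "bij_betw f V V'" and E: "E \<subseteq> V \<times> V" and E': "E' = map_prod f f ` E"
  shows "top_eig V' E' = top_eig V E"
proof -
  have inj: "inj_on f V" and im: "f ` V = V'" using f by (auto simp: bij_betw_def)
  have n: "sq_norm_on V' x = sq_norm_on V (x \<circ> f)" for x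
    unfolding sq_norm_on_def using sum.reindex_bij_betw[OF f, of "\<lambda>v. (x v)\<^sup>2"] by simp
  have q: "qform V' E' x = qform V E (x \<circ> f)" for x
  proof -
    have "inj_on (map_prod f f) E"
      by (rule inj_on_subset[OF map_prod_inj_on[OF inj inj] E])
    then show ?thesis
      unfolding bform_def E' using sum.reindex_bij_betw[OF f, of x]
      by (simp add: sum.reindex case_prod_unfold)
  qed
  have "qform V' E' ` {x. sq_norm_on V' x = 1} = qform V E ` {x. sq_norm_on V x = 1}" (is "?A = ?B")
  proof
    show "?A \<subseteq> ?B" using n q by auto
    show "?B \<subseteq> ?A"
    proof
      fix k assume "k \<in> ?B"
      then obtain y where y: "sq_norm_on V y = 1" "k = qform V E y" by blast
      define x where "x = y \<circ> inv_into V f"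
      have xf: "(x \<circ> f) v = y v" if "v \<in> V" for v using that inj by (simp add: x_def)
      have "sq_norm_on V (x \<circ> f) = sq_norm_on V y"
        unfolding sq_norm_on_def using xf by (intro sum.cong) auto
      moreover have "qform V E (x \<circ> f) = qform V E y"
      proof -
        have "(\<Sum>(u, v)\<in>E. (x \<circ> f) u * (x \<circ> f) v) = (\<Sum>(u, v)\<in>E. y u * y v)"
          using E xf by (intro sum.cong) auto
        moreover have "(\<Sum>v\<in>V. (x \<circ> f) v) = (\<Sum>v\<in>V. y v)" using xf by (intro sum.cong) auto
        ultimately show ?thesis unfolding bform_def by metis
      qed
      ultimately show "k \<in> ?A" using y n q by (metis (mono_tags, lifting) image_eqI mem_Collect_eq)
    qed
  qed
  then show ?thesis by (simp add: top_eig_def)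
qed

lemma digraph_iso_with_proj_iff:
  assumes "pair_wf_digraph H"
  shows "digraph_iso (with_proj H) (with_proj H') \<longleftrightarrow>
    (\<exists>f. bij_betw f (pverts H) (pverts H') \<and> parcs H' = map_prod f f ` parcs H)"
proof
  interpret pair_wf_digraph H by fact
  assume "digraph_iso (with_proj H) (with_proj H')"
  then obtain h where h: "pre_digraph.digraph_isomorphism (with_proj H) h"
    and H': "with_proj H' = app_iso h (with_proj H)"
    by (auto simp: digraph_iso_def)
  let ?f = "iso_verts h"
  have vs: "pverts H' = ?f ` pverts H" using arg_cong[OF H', of verts] by simp
  have as: "parcs H' = iso_arcs h ` parcs H" using arg_cong[OF H', of arcs] by simp
  have t: "iso_tail h = fst" using arg_cong[OF H', of tail] by simp
  have hd: "iso_head h = snd" using arg_cong[OF H', of head] by simp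
  have "iso_arcs h a = map_prod ?f ?f a" if "a \<in> parcs H" for a
    using h that t hd unfolding pre_digraph.digraph_isomorphism_def
    by (auto simp: prod_eq_iff)
  then have "parcs H' = map_prod ?f ?f ` parcs H" using as by auto
  moreover have "bij_betw ?f (pverts H) (pverts H')"
    using h vs unfolding pre_digraph.digraph_isomorphism_def by (auto simp: bij_betw_def)
  ultimately show "\<exists>f. bij_betw f (pverts H) (pverts H') \<and> parcs H' = map_prod f f ` parcs H" by blast
next
  interpret pair_wf_digraph H by fact
  assume "\<exists>f. bij_betw f (pverts H) (pverts H') \<and> parcs H' = map_prod f f ` parcs H"
  then obtain f where f: "bij_betw f (pverts H) (pverts H')" "parcs H' = map_prod f f ` parcs H"
    by blast
  let ?h = "\<lparr>iso_verts = f, iso_arcs = map_prod f f, iso_head = snd, iso_tail = fst\<rparr>"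
  have inj: "inj_on f (pverts H)" using f(1) by (simp add: bij_betw_def)
  have "inj_on (map_prod f f) (parcs H)"
    by (rule inj_on_subset[OF map_prod_inj_on[OF inj inj]]) (auto intro: in_arcsD1 in_arcsD2)
  then have "pre_digraph.digraph_isomorphism (with_proj H) ?h"
    using inj wf_digraph_axioms unfolding pre_digraph.digraph_isomorphism_def by auto
  moreover have "with_proj H' = app_iso ?h (with_proj H)"
    using f by (auto simp: with_proj_def app_iso_def bij_betw_def)
  ultimately show "digraph_iso (with_proj H) (with_proj H')"
    unfolding digraph_iso_def by blast
qed

lemma complement_iso:
  assumes f: "bij_betw f (pverts H) (pverts H')" and E': "parcs H' = map_prod f f ` parcs H"
    and H: "pair_wf_digraph H"
  shows "parcs (complement H') = map_prod f f ` parcs (complement H)"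
proof -
  interpret pair_wf_digraph H by fact
  have inj: "inj_on f (pverts H)" and im: "pverts H' = f ` pverts H"
    using f by (auto simp: bij_betw_def)
  have arc: "(f u, f v) \<in> parcs H' \<longleftrightarrow> (u, v) \<in> parcs H" if "u \<in> pverts H" "v \<in> pverts H" for u v
    unfolding E' using that inj by (auto dest: inj_onD in_arcsD1 in_arcsD2)
  have "(a, b) \<in> parcs (complement H') \<longleftrightarrow> (a, b) \<in> map_prod f f ` parcs (complement H)" for a b
  proof
    assume "(a, b) \<in> parcs (complement H')"
    then obtain u v where "u \<in> pverts H" "v \<in> pverts H" "a = f u" "b = f v" "f u \<noteq> f v"
      "(f u, f v) \<notin> parcs H'" by (auto simp: im)
    then show "(a, b) \<in> map_prod f f ` parcs (complement H)"
      using arc by (intro image_eqI[of _ _ "(u, v)"]) auto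
  next
    assume "(a, b) \<in> map_prod f f ` parcs (complement H)"
    then show "(a, b) \<in> parcs (complement H')"
      using arc inj by (auto simp: im dest: inj_onD)
  qed
  then show ?thesis by (metis subrelI subset_antisym)
qed

lemma parent_edges_image:
  assumes "\<And>w. w \<in> R \<Longrightarrow> p' (f w) = f (p w)"
  shows "parent_edges (f ` R) p' = map_prod f f ` parent_edges R p"
  using assms by (auto simp: parent_edges_def image_Un image_image)

lemma bij_betw_fun_upd_insert:
  assumes "bij_betw f A B" "a \<notin> A" "b \<notin> B"
  shows "bij_betw (f(a := b)) (insert a A) (insert b B)"
  using assms by (auto simp: bij_betw_def inj_on_def)

lemma star_edges_iso:
  assumes V: "finite V" "r \<in> V" "R \<subseteq> V - {r}" and V': "finite V'" "r' \<in> V'" "R' \<subseteq> V' - {r'}"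
    and card: "card V = card V'" "card R = card R'"
  shows "\<exists>f. bij_betw f V V' \<and> star_edges R' r' = map_prod f f ` star_edges R r"
proof -
  have finR: "finite R" "finite R'" using V V' finite_subset by blast+
  obtain g where g: "bij_betw g R R'" using finite_same_card_bij[OF finR card(2)] by blast
  have "card (V - {r} - R) = card (V' - {r'} - R')"
    using V V' card by (simp add: card_Diff_subset finR)
  then obtain h where h: "bij_betw h (V - {r} - R) (V' - {r'} - R')"
    by (metis finite_same_card_bij finite_Diff V(1) V'(1))
  define f where "f = (\<lambda>w. if w \<in> R then g w else h w)(r := r')"
  have "bij_betw (\<lambda>w. if w \<in> R then g w else h w) (R \<union> (V - {r} - R)) (R' \<union> (V' - {r'} - R'))"
    by (rule bij_betw_disjoint_Un[OF g h]) auto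
  then have "bij_betw (\<lambda>w. if w \<in> R then g w else h w) (V - {r}) (V' - {r'})"
    using V V' by (simp add: Un_absorb1)
  from bij_betw_fun_upd_insert[OF this, of r r'] have "bij_betw f V V'"
    using V V' by (simp add: f_def insert_absorb)
  moreover have "f ` R = R'"
    using g V by (auto simp: f_def bij_betw_def)
  then have "star_edges R' r' = map_prod f f ` star_edges R r"
    using parent_edges_image[of R "\<lambda>_. r'" f "\<lambda>_. r"] by (simp add: f_def)
  ultimately show ?thesis by blast
qed

lemma dstar_edges_iso:
  assumes V: "finite V" "r \<in> V" "R \<subseteq> V - {r}" "b \<in> R" "z \<in> R" "b \<noteq> z"
    and V': "finite V'" "r' \<in> V'" "R' \<subseteq> V' - {r'}" "b' \<in> R'" "z' \<in> R'" "b' \<noteq> z'"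
    and card: "card V = card V'" "card R = card R'"
  shows "\<exists>f. bij_betw f V V' \<and> dstar_edges R' r' b' z' = map_prod f f ` dstar_edges R r b z"
proof -
  have finR: "finite R" "finite R'" using V V' finite_subset by blast+
  have "card (R - {b} - {z}) = card (R' - {b'} - {z'})"
    using V V' card finR by simp
  then obtain g where g: "bij_betw g (R - {b} - {z}) (R' - {b'} - {z'})"
    by (metis finite_same_card_bij finite_Diff finR)
  have "card (V - {r} - R) = card (V' - {r'} - R')"
    using V V' card by (simp add: card_Diff_subset finR)
  then obtain h where h: "bij_betw h (V - {r} - R) (V' - {r'} - R')"
    by (metis finite_same_card_bij finite_Diff V(1) V'(1))
  define g' where "g' = g(z := z', b := b')"
  have "bij_betw (g(z := z')) (R - {b}) (R' - {b'})"
    using bij_betw_fun_upd_insert[OF g, of z z'] V V' by (simp add: insert_absorb)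
  from bij_betw_fun_upd_insert[OF this, of b b'] have g': "bij_betw g' R R'"
    using V V' by (simp add: g'_def insert_absorb)
  define f where "f = (\<lambda>w. if w \<in> R then g' w else h w)(r := r')"
  have "bij_betw (\<lambda>w. if w \<in> R then g' w else h w) (R \<union> (V - {r} - R)) (R' \<union> (V' - {r'} - R'))"
    by (rule bij_betw_disjoint_Un[OF g' h]) auto
  then have "bij_betw (\<lambda>w. if w \<in> R then g' w else h w) (V - {r}) (V' - {r'})"
    using V V' by (simp add: Un_absorb1)
  from bij_betw_fun_upd_insert[OF this, of r r'] have bij: "bij_betw f V V'"
    using V V' by (simp add: f_def insert_absorb)
  have fs: "f b = b'" "f z = z'" "f r = r'"
    using V by (auto simp: f_def g'_def)
  have "f ` R = R'"
    using g' V by (auto simp: f_def bij_betw_def)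
  moreover have "(if f w = z' then b' else r') = f (if w = z then b else r)" if "w \<in> R" for w
  proof -
    have "f w = f z \<longleftrightarrow> w = z" using bij that V by (auto simp: bij_betw_def dest: inj_onD)
    then show ?thesis using fs by simp
  qed
  ultimately have "dstar_edges R' r' b' z' = map_prod f f ` dstar_edges R r b z"
    using parent_edges_image[of R "\<lambda>w. if w = z' then b' else r'" f "\<lambda>w. if w = z then b else r"] by simp
  with bij show ?thesis by blast
qed

section \<open>Rooting a forest\<close>

text \<open>
  Choose a root in every component, \<open>r\<close> being one of them, and let the parent of any other vertex be
  the next vertex on a shortest walk to its root. The parent edges connect every component. An
  edge outside of them would close a path of parent edges to a cycle, and this cycle has length at
  least 3 because the path has length at least 2.
\<close>

lemma simple_forest_parent_edges:
  assumes F: "simple_forest F" and r: "r \<in> pverts F"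
  shows "\<exists>R p. R \<subseteq> pverts F - {r}
    \<and> card R = card (pverts F) - card (pre_digraph.sccs (with_proj F))
    \<and> p ` R \<subseteq> pverts F \<and> parcs F = parent_edges R p
    \<and> (\<forall>w\<in>R. p w \<in> R \<longrightarrow> p (p w) \<noteq> w)"
proof -
  have acyclic: "\<not> pre_digraph.cycle (with_proj F) c" if "3 \<le> length c" for c
    using F that by (auto simp: simple_forest_def)
  interpret pair_graph F using F by (simp add: simple_forest_def)
  define V E where "V = pverts F" and "E = parcs F"
  have scc: "scc_of u = {v. (u, v) \<in> E\<^sup>* \<and> v \<in> V}" if "u \<in> V" for u
  proof -
    have "sym (E\<^sup>*)" by (rule sym_rtrancl) (auto simp: E_def sym_def arcs_symmetric)
    then show ?thesis using that
      by (auto simp: scc_of_def reachable_conv E_def V_def dest: symD)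
  qed
  have scc_self: "u \<in> V \<Longrightarrow> u \<in> scc_of u" for u by (simp add: scc)
  have scc_eq: "scc_of u = scc_of v" if "v \<in> scc_of u" for u v
    using that by (auto simp: scc_of_def intro: reachable_trans)
  have scc_sub: "scc_of u \<subseteq> V" if "u \<in> V" for u using scc[OF that] by auto
  \<comment> \<open>The root of a component \<open>S\<close>.\<close>
  define g where "g S = (if r \<in> S then r else (SOME v. v \<in> S))" for S
  define rep where "rep u = g (scc_of u)" for u
  have g_in: "g (scc_of u) \<in> scc_of u" if "u \<in> V" for u
    using scc_self[OF that] by (auto simp: g_def intro: someI)
  have scc_rep: "scc_of (rep u) = scc_of u" if "u \<in> V" for u
    using scc_eq[OF g_in[OF that]] by (simp add: rep_def)
  have rep_V: "rep u \<in> V" if "u \<in> V" for u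
    using g_in[OF that] scc_sub[OF that] by (auto simp: rep_def)
  have rep_rep: "rep (rep u) = rep u" if "u \<in> V" for u
    using scc_rep[OF that] by (simp add: rep_def)
  have rep_edge: "rep u = rep v" if "(u, v) \<in> E" for u v
  proof -
    have "v \<in> scc_of u" using that scc[of u] by (auto simp: E_def V_def dest: in_arcsD1 in_arcsD2)
    then show ?thesis using scc_eq by (simp add: rep_def)
  qed
  have rep_r: "rep r = r" using scc_self[of r] r by (simp add: rep_def g_def V_def)
  define R where "R = V - rep ` V"
  have "r \<in> rep ` V" using rep_r r by (metis V_def imageI)
  then have R_sub: "R \<subseteq> V - {r}" by (auto simp: R_def)
  have R_iff: "w \<in> R \<longleftrightarrow> w \<in> V \<and> rep w \<noteq> w" for w
    using rep_rep by (force simp: R_def)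
  have "card (rep ` V) = card (pre_digraph.sccs (with_proj F))"
  proof -
    have "inj_on g (scc_of ` V)"
      by (rule inj_onI) (metis (no_types, lifting) imageE rep_def scc_rep)
    then have "card (g ` scc_of ` V) = card (scc_of ` V)" by (rule card_image)
    moreover have "card (scc_of ` V) = card sccs"
      by (simp add: V_def flip: sccs_verts_conv_scc_of card_sccs_verts)
    ultimately show ?thesis by (simp add: image_image rep_def)
  qed
  moreover have "card R = card V - card (rep ` V)"
    unfolding R_def using rep_V pair_finite_verts by (intro card_Diff_subset) (auto simp: V_def)
  ultimately have card_R: "card R = card V - card (pre_digraph.sccs (with_proj F))" by simp
  \<comment> \<open>The distance to the root.\<close>
  define d where "d w = (LEAST k. (w, rep w) \<in> E ^^ k)" for w
  have "\<forall>w\<in>R. \<exists>y. (w, y) \<in> E \<and> d y < d w"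
  proof
    fix w assume "w \<in> R"
    then have w: "w \<in> V" "rep w \<noteq> w" using R_iff by auto
    have "rep w \<in> scc_of w" using g_in[OF w(1)] by (simp add: rep_def)
    then have "(w, rep w) \<in> E\<^sup>*" using scc[OF w(1)] by auto
    then have "\<exists>k. (w, rep w) \<in> E ^^ k" by (simp add: rtrancl_power)
    then have dw: "(w, rep w) \<in> E ^^ d w" unfolding d_def by (rule LeastI_ex)
    then obtain k where k: "d w = Suc k" using w(2) by (cases "d w") auto
    then obtain y where y: "(w, y) \<in> E" "(y, rep w) \<in> E ^^ k"
      using dw relpow_Suc_D2 by metis
    then have "d y \<le> k" unfolding d_def using rep_edge[OF y(1)] by (intro Least_le) simp
    then show "\<exists>y. (w, y) \<in> E \<and> d y < d w" using k y(1) by auto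
  qed
  then obtain p where p: "\<And>w. w \<in> R \<Longrightarrow> (w, p w) \<in> E" "\<And>w. w \<in> R \<Longrightarrow> d (p w) < d w"
    using bchoice[of R "\<lambda>w y. (w, y) \<in> E \<and> d y < d w"] by blast
  have no2: "p (p w) \<noteq> w" if "w \<in> R" "p w \<in> R" for w
    using p(2)[OF that(1)] p(2)[OF that(2)] by auto
  define T where "T = parent_edges R p"
  have TE: "T \<subseteq> E" using p(1) by (auto simp: T_def parent_edges_def E_def arcs_symmetric)
  have TV: "T \<subseteq> V \<times> V"
    using TE by (force simp: E_def V_def intro: in_arcsD1 in_arcsD2)
  have symT: "sym (T\<^sup>*)" by (rule sym_rtrancl) (auto simp: T_def parent_edges_def sym_def)
  have to_rep: "(w, rep w) \<in> T\<^sup>*" if "w \<in> V" for w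
    using that
  proof (induction "d w" arbitrary: w rule: less_induct)
    case less
    show ?case
    proof (cases "w \<in> R")
      case True
      have "p w \<in> V" using p(1)[OF True] by (auto simp: E_def V_def dest: in_arcsD2)
      then have "(p w, rep (p w)) \<in> T\<^sup>*" using less.hyps p(2)[OF True] by blast
      moreover have "(w, p w) \<in> T" using True by (simp add: T_def parent_edges_def)
      ultimately show ?thesis using rep_edge[OF p(1)[OF True]] by (metis converse_rtrancl_into_rtrancl)
    next
      case False
      then show ?thesis using less.prems R_iff by auto
    qed
  qed
  have ET: "E \<subseteq> T"
  proof (rule subrelI, rule ccontr)
    fix u v assume uv: "(u, v) \<in> E" "(u, v) \<notin> T"
    have uvV: "u \<in> V" "v \<in> V" "u \<noteq> v"
      using uv(1) no_loops' by (auto simp: E_def V_def dest: in_arcsD1 in_arcsD2)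
    have "(rep v, v) \<in> T\<^sup>*" using to_rep[OF uvV(2)] symT by (auto dest: symD)
    then have uvT: "(u, v) \<in> T\<^sup>*" using to_rep[OF uvV(1)] rep_edge[OF uv(1)] by simp
    define G where "G = \<lparr>pverts = V, parcs = T\<rparr>"
    interpret G: pair_wf_digraph G
      using TV by unfold_locales (auto simp: G_def)
    have "u \<rightarrow>\<^sup>*\<^bsub>with_proj G\<^esub> v" using uvT uvV by (simp add: G.reachable_conv) (simp add: G_def)
    then obtain P where P: "G.apath u P v" using G.reachable_apath by blast
    have cas: "pcas u P v" and PT: "set P \<subseteq> T" and dist: "distinct (pawalk_verts u P)"
      using P unfolding G.apath_def G.awalk_def by (auto simp: G_def)
    have "P \<noteq> []" using cas uvV by auto
    moreover have "length P \<noteq> 1"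
      using cas PT uv(2) by (auto simp: length_Suc_conv)
    ultimately have "2 \<le> length P" by (cases P rule: list.exhaust) (auto simp: Suc_le_eq)
    moreover have "cycle ((v, u) # P)"
      unfolding cycle_def awalk_def
      using cas PT TE dist uvV arcs_symmetric[of u v] uv(1) by (auto simp: E_def V_def)
    ultimately show False using acyclic[of "(v, u) # P"] by simp
  qed
  have "parcs F = parent_edges R p" using TE ET by (auto simp: E_def T_def)
  moreover have "p ` R \<subseteq> pverts F" using p(1) by (auto simp: E_def dest: in_arcsD2)
  ultimately show ?thesis using R_sub card_R no2 unfolding V_def by blast
qed

text \<open>
  A vertex in another component is not adjacent to either end of an edge.
\<close>

lemma simple_forest_far_vertex:
  assumes F: "simple_forest F" and c: "2 \<le> card (pre_digraph.sccs (with_proj F))"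
    and uv: "(u, v) \<in> parcs F"
  shows "\<exists>w\<in>pverts F. w \<noteq> u \<and> w \<noteq> v \<and> (u, w) \<notin> parcs F \<and> (w, v) \<notin> parcs F"
proof -
  interpret pair_graph F using F by (simp add: simple_forest_def)
  have u: "u \<in> pverts F" using uv by (rule in_arcsD1)
  have "card (scc_of ` pverts F) \<ge> 2"
    using c by (simp flip: card_sccs_verts add: sccs_verts_conv_scc_of)
  then have "\<not> scc_of ` pverts F \<subseteq> {scc_of u}"
    using card_mono[of "{scc_of u}" "scc_of ` pverts F"] by auto
  then obtain w where w: "w \<in> pverts F" "scc_of w \<noteq> scc_of u" by auto
  have adj: "scc_of x = scc_of y" if "(x, y) \<in> parcs F" for x y
  proof -
    have "x \<rightarrow>\<^sup>*\<^bsub>with_proj F\<^esub> y" "y \<rightarrow>\<^sup>*\<^bsub>with_proj F\<^esub> x" using that arcs_symmetric[OF that] by auto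
    then show ?thesis by (auto simp: scc_of_def intro: reachable_trans)
  qed
  have "w \<noteq> u" "w \<noteq> v" "(u, w) \<notin> parcs F" "(w, v) \<notin> parcs F"
    using w adj[OF uv] adj by metis+
  with w(1) show ?thesis by blast
qed

section \<open>The extremal graphs\<close>

lemma disjoint_union_copies_K1:
  "pverts (disjoint_union H (copies k K1)) = Inl ` pverts H \<union> Inr ` ({..<k} \<times> {()})"
  "parcs (disjoint_union H (copies k K1)) = map_prod Inl Inl ` parcs H"
  by (auto simp: disjoint_union_def copies_def K1_def)

lemma parcs_star:
  "parcs (star (m + 1)) = star_edges {1..<m + 1} 0"
  by (auto simp: star_def parent_edges_def)

lemma parcs_double_star:
  assumes "2 \<le> m"
  shows "parcs (double_star (m + 1) 1)
    = dstar_edges ({Inl 0, Inl 1} \<union> Inr ` {1..<m - 1}) (Inr 0) (Inl 0) (Inl 1)"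
proof -
  let ?p = "\<lambda>w :: nat + nat. if w = Inl 1 then Inl 0 else Inr 0 :: nat + nat"
  obtain k where k: "m = k + 2" using assms nat_le_iff_add by (metis add.commute)
  have inner: "map_prod Inr Inr ` parcs (star (k + 1)) = parent_edges (Inr ` {1..<k + 1}) ?p"
    unfolding parcs_star by (rule parent_edges_image[symmetric]) simp
  have "parcs (double_star (m + 1) 1)
      = map_prod Inl Inl ` parcs (star (1 + 1)) \<union> map_prod Inr Inr ` parcs (star (k + 1))
        \<union> {(Inl 0, Inr 0), (Inr 0, Inl 0)}"
    by (simp add: double_star_def Let_def disjoint_union_def k)
  also have "map_prod Inl Inl ` parcs (star (1 + 1)) = {(Inl 0, Inl 1), (Inl 1, Inl 0)}"
    unfolding parcs_star by (auto simp: parent_edges_def)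
  finally have "parcs (double_star (m + 1) 1)
      = {(Inl 0, Inl 1), (Inl 1, Inl 0), (Inl 0, Inr 0), (Inr 0, Inl 0)}
        \<union> parent_edges (Inr ` {1..<k + 1}) ?p"
    unfolding inner by blast
  also have "{(Inl 0, Inl 1), (Inl 1, Inl 0), (Inl 0, Inr 0), (Inr 0, Inl 0)}
      = parent_edges {Inl 0, Inl 1} ?p"
    by (auto simp: parent_edges_def)
  finally show ?thesis
    by (simp add: parent_edges_def image_Un k Un_ac)
qed

lemma pair_graph_parent_edges:
  assumes "finite (pverts H)" "parcs H = parent_edges R p" "R \<subseteq> pverts H" "p ` R \<subseteq> pverts H"
    and "\<And>w. w \<in> R \<Longrightarrow> p w \<noteq> w"
  shows "pair_graph H"
proof -
  have "finite (parcs H)" using assms finite_subset[of R] by (simp add: parent_edges_def)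
  moreover have "sym (parcs H)" using assms by (auto simp: parent_edges_def sym_def)
  moreover have "e \<in> parcs H \<Longrightarrow> fst e \<in> pverts H \<and> snd e \<in> pverts H \<and> fst e \<noteq> snd e" for e
    using assms(3-5) unfolding assms(2) by (force simp: parent_edges_def)
  ultimately show ?thesis
    using assms(1) by unfold_locales (auto simp: symmetric_def)
qed

text \<open>
  An isolated vertex is adjacent to all other vertices in the complement.
\<close>

lemma dist_spectral_radius_with_isolated_vertex:
  assumes H: "pair_graph H" and w: "w \<in> pverts H" "w \<notin> Domain (parcs H)"
  shows "dist_spectral_radius (complement H) = top_eig (pverts H) (parcs H) - 1"
proof (rule dist_spectral_radius_complement[OF H])
  interpret pair_graph H by fact
  fix u v assume "(u, v) \<in> parcs H"
  then show "\<exists>w\<in>pverts H. w \<noteq> u \<and> w \<noteq> v \<and> (u, w) \<notin> parcs H \<and> (w, v) \<notin> parcs H"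
    using w by (intro bexI[of _ w]) (auto dest: arcs_symmetric)
qed (use w in auto)

lemma star_with_isolated_vertices:
  fixes S :: "(nat + nat \<times> unit) pair_pre_digraph" and m k :: nat
  defines "S \<equiv> disjoint_union (star (m + 1)) (copies k K1)"
  assumes "1 \<le> k"
  obtains r R where "finite (pverts S)" "card (pverts S) = m + 1 + k" "r \<in> pverts S"
    "R \<subseteq> pverts S - {r}" "card R = m" "parcs S = star_edges R r"
    "dist_spectral_radius (complement S) = top_eig (pverts S) (parcs S) - 1"
proof -
  define R :: "(nat + nat \<times> unit) set" where "R = Inl ` {1..<m + 1}"
  have parcs: "parcs S = star_edges R (Inl 0)"
    unfolding S_def R_def disjoint_union_copies_K1 parcs_star
    by (rule parent_edges_image[symmetric]) simp
  have pverts: "pverts S = Inl ` {..<m + 1} \<union> Inr ` ({..<k} \<times> {()})"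
    by (simp add: S_def disjoint_union_copies_K1) (simp add: star_def)
  have R: "Inl 0 \<in> pverts S" "R \<subseteq> pverts S - {Inl 0}" "card R = m" "finite (pverts S)"
    by (auto simp: pverts R_def card_image)
  have card: "card (pverts S) = m + 1 + k"
    unfolding pverts by (subst card_Un_disjoint) (auto simp: card_image card_cartesian_product)
  have S: "pair_graph S"
    by (rule pair_graph_parent_edges[OF R(4) parcs]) (use R in auto)
  have "dist_spectral_radius (complement S) = top_eig (pverts S) (parcs S) - 1"
    by (rule dist_spectral_radius_with_isolated_vertex[OF S, of "Inr (0, ())"])
      (use assms(2) in \<open>auto simp: pverts parcs parent_edges_def R_def\<close>)
  then show thesis by (rule that[OF R(4) card R(1-3) parcs])
qed

lemma double_star_with_isolated_vertices:
  fixes D :: "((nat + nat) + nat \<times> unit) pair_pre_digraph" and m k :: nat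
  defines "D \<equiv> disjoint_union (double_star (m + 1) 1) (copies k K1)"
  assumes "1 \<le> k" and m: "2 \<le> m"
  obtains r R b z where "finite (pverts D)" "card (pverts D) = m + 1 + k" "r \<in> pverts D"
    "R \<subseteq> pverts D - {r}" "b \<in> R" "z \<in> R" "b \<noteq> z" "card R = m" "parcs D = dstar_edges R r b z"
    "dist_spectral_radius (complement D) = top_eig (pverts D) (parcs D) - 1"
proof -
  define R :: "((nat + nat) + nat \<times> unit) set"
    where "R = Inl ` ({Inl 0, Inl 1} \<union> Inr ` {1..<m - 1})"
  have parcs: "parcs D = dstar_edges R (Inl (Inr 0)) (Inl (Inl 0)) (Inl (Inl 1))"
    unfolding D_def R_def disjoint_union_copies_K1 parcs_double_star[OF m]
    by (rule parent_edges_image[symmetric]) auto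
  have pverts: "pverts D = Inl ` ({Inl 0, Inl 1} \<union> Inr ` {..<m - 1}) \<union> Inr ` ({..<k} \<times> {()})"
    by (simp add: D_def disjoint_union_copies_K1)
      (auto simp: double_star_def Let_def disjoint_union_def star_def)
  have R: "Inl (Inr 0) \<in> pverts D" "R \<subseteq> pverts D - {Inl (Inr 0)}"
      "Inl (Inl 0) \<in> R" "Inl (Inl 1) \<in> R" and fin: "finite (pverts D)"
    using m by (auto simp: pverts R_def)
  have card_tree: "card (Inl ` ({Inl 0, Inl 1} \<union> Inr ` A) :: ((nat + nat) + nat \<times> unit) set)
      = 2 + card A" if A: "finite A" for A :: "nat set"
  proof -
    have "card (Inl ` ({Inl 0, Inl 1} \<union> Inr ` A) :: ((nat + nat) + nat \<times> unit) set)
        = card ({Inl 0, Inl 1} \<union> Inr ` A :: (nat + nat) set)"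
      by (rule card_image[OF inj_onI]) simp
    also have "\<dots> = 2 + card (Inr ` A :: (nat + nat) set)"
      using A by (subst card_Un_disjoint) auto
    finally show ?thesis by (simp add: card_image)
  qed
  have card_R: "card R = m"
    unfolding R_def card_tree[OF finite_atLeastLessThan] using m by simp
  have card_D: "card (pverts D) = m + 1 + k"
  proof -
    have "card (pverts D)
        = card (Inl ` ({Inl 0, Inl 1} \<union> Inr ` {..<m - 1}) :: ((nat + nat) + nat \<times> unit) set)
          + card (Inr ` ({..<k} \<times> {()}) :: ((nat + nat) + nat \<times> unit) set)"
      unfolding pverts by (rule card_Un_disjoint) auto
    then show ?thesis
      unfolding card_tree[OF finite_lessThan]
      using m by (simp add: card_image card_cartesian_product)
  qed
  have D: "pair_graph D"
    by (rule pair_graph_parent_edges[OF fin parcs]) (use R in auto)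
  have "dist_spectral_radius (complement D) = top_eig (pverts D) (parcs D) - 1"
    by (rule dist_spectral_radius_with_isolated_vertex[OF D, of "Inr (0, ())"])
      (use assms(2) in \<open>auto simp: pverts parcs parent_edges_def R_def\<close>)
  from that[OF fin card_D R _ card_R parcs this] show thesis by simp
qed

theorem theorem3p1:
  fixes n c :: nat and F G :: "'a pair_pre_digraph"
  assumes "c \<ge> 2" and "n - c + 1 \<ge> 4"
    and "simple_forest F"
    and "card (pverts F) = n"
    and "card (pre_digraph.sccs (with_proj F)) = c"
    and "G = complement F"
    and "\<not> digraph_iso (with_proj G)
           (with_proj (complement (disjoint_union (star (n - c + 1)) (copies (c - 1) K1))))"
  shows "dist_spectral_radius G
           \<le> dist_spectral_radius
               (complement (disjoint_union (double_star (n - c + 1) 1) (copies (c - 1) K1)))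
       \<and> dist_spectral_radius
           (complement (disjoint_union (double_star (n - c + 1) 1) (copies (c - 1) K1)))
           < dist_spectral_radius
               (complement (disjoint_union (star (n - c + 1)) (copies (c - 1) K1)))
       \<and> (dist_spectral_radius G
             = dist_spectral_radius
                 (complement (disjoint_union (double_star (n - c + 1) 1) (copies (c - 1) K1)))
           \<longleftrightarrow> digraph_iso (with_proj (complement G))
                 (with_proj (disjoint_union (double_star (n - c + 1) 1) (copies (c - 1) K1))))"
proof -
  define m where "m = n - c"
  have m: "3 \<le> m" "n = m + c" using assms(2) by (auto simp: m_def)
  define V where "V = pverts F"
  have F: "pair_graph F" using assms(3) by (simp add: simple_forest_def)
  interpret F: pair_graph F by fact
  have finV: "finite V" and cardV: "card V = m + c"
    using F.pair_finite_verts assms(4) m by (auto simp: V_def)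
  then have "V \<noteq> {}" using m by auto

  define S where "S = disjoint_union (star (m + 1)) (copies (c - 1) K1)"
  define D where "D = disjoint_union (double_star (m + 1) 1) (copies (c - 1) K1)"
  have k: "1 \<le> c - 1" using assms(1) by simp
  obtain rS RS where finS: "finite (pverts S)" and cardS: "card (pverts S) = m + 1 + (c - 1)"
    and RS: "rS \<in> pverts S" "RS \<subseteq> pverts S - {rS}" "card RS = m"
    and parcsS: "parcs S = star_edges RS rS"
    and rho_S: "dist_spectral_radius (complement S) = top_eig (pverts S) (parcs S) - 1"
    using star_with_isolated_vertices[OF k, of m] unfolding S_def by metis
  have "2 \<le> m" using m by simp
  from double_star_with_isolated_vertices[OF k this]
  obtain rD RD bD zD where finD: "finite (pverts D)" and cardD: "card (pverts D) = m + 1 + (c - 1)"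
    and RD: "rD \<in> pverts D" "RD \<subseteq> pverts D - {rD}" "bD \<in> RD" "zD \<in> RD" "bD \<noteq> zD" "card RD = m"
    and parcsD: "parcs D = dstar_edges RD rD bD zD"
    and rho_D: "dist_spectral_radius (complement D) = top_eig (pverts D) (parcs D) - 1"
    unfolding D_def by blast
  have rho_F: "dist_spectral_radius G = top_eig V (parcs F) - 1"
    unfolding assms(6) V_def
    by (rule dist_spectral_radius_complement[OF F])
      (use \<open>V \<noteq> {}\<close> simple_forest_far_vertex[OF assms(3)] assms(1,5) in \<open>auto simp: V_def\<close>)

  \<comment> \<open>Every star and every double star of the right size on \<open>V\<close> is a copy of the model, so that all
    comparisons can take place on \<open>V\<close>.\<close>
  have star_on_V: "\<exists>f. bij_betw f V (pverts S) \<and> parcs S = map_prod f f ` star_edges R r"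
    if "r \<in> V" "R \<subseteq> V - {r}" "card R = m" for r R
    unfolding parcsS by (rule star_edges_iso) (use that finV cardV RS finS cardS k in auto)
  have dstar_on_V: "\<exists>f. bij_betw f V (pverts D) \<and> parcs D = map_prod f f ` dstar_edges R r b z"
    if "r \<in> V" "R \<subseteq> V - {r}" "card R = m" "b \<in> R" "z \<in> R" "b \<noteq> z" for r R b z
    unfolding parcsD by (rule dstar_edges_iso) (use that finV cardV RD finD cardD k in auto)
  have parent_sub: "parent_edges R p \<subseteq> V \<times> V" if "R \<subseteq> V" "p ` R \<subseteq> V" for R p
    using that by (auto simp: parent_edges_def)
  have top_S: "top_eig (pverts S) (parcs S) = top_eig V (star_edges R r)"
    if "r \<in> V" "R \<subseteq> V - {r}" "card R = m" for r R
    using star_on_V[OF that] top_eig_iso parent_sub[of R "\<lambda>_. r"] that by blast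
  have top_D: "top_eig (pverts D) (parcs D) = top_eig V (dstar_edges R r b z)"
    if h: "r \<in> V" "R \<subseteq> V - {r}" "card R = m" "b \<in> R" "z \<in> R" "b \<noteq> z" for r R b z
  proof -
    obtain f where "bij_betw f V (pverts D)" "parcs D = map_prod f f ` dstar_edges R r b z"
      using dstar_on_V[OF h] by blast
    then show ?thesis
      by (intro top_eig_iso parent_sub) (use h in auto)
  qed

  interpret FV: finite_sym_rel V "parcs F"
    unfolding V_def using finite_sym_rel_pair_graph[OF F] \<open>V \<noteq> {}\<close> by (simp add: V_def)
  obtain x where pos: "\<And>v. v \<in> V \<Longrightarrow> x v > 0"
    and eq: "qform V (parcs F) x = top_eig V (parcs F) * sq_norm_on V x"
    using FV.top_eig_perron by blast
  \<comment> \<open>Root the forest at a vertex where the positive eigenvector is largest.\<close>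
  have "Max (x ` V) \<in> x ` V" using finV \<open>V \<noteq> {}\<close> by simp
  then obtain r where r: "r \<in> V" "x r = Max (x ` V)" by auto
  have max: "x v \<le> x r" if "v \<in> V" for v using r finV that by simp
  obtain R p where R: "R \<subseteq> V - {r}" "card R = m" "p ` R \<subseteq> V" "parcs F = parent_edges R p"
    and acyc: "\<And>w. w \<in> R \<Longrightarrow> p w \<in> R \<Longrightarrow> p (p w) \<noteq> w"
    using simple_forest_parent_edges[OF assms(3), of r] r(1) assms(4,5)
    unfolding V_def m_def by metis
  have nstar: "\<exists>w\<in>R. p w \<noteq> r"
  proof (rule ccontr)
    assume "\<not> (\<exists>w\<in>R. p w \<noteq> r)"
    then have "parcs F = star_edges R r" unfolding R(4) by (intro parent_edges_cong) auto
    then obtain f where f: "bij_betw f (pverts F) (pverts S)" "parcs S = map_prod f f ` parcs F"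
      using star_on_V[OF r(1) R(1,2)] by (auto simp: V_def)
    have "parcs (complement S) = map_prod f f ` parcs (complement F)"
      by (rule complement_iso[OF f F.pair_wf_digraph])
    moreover have "pair_wf_digraph (complement F)"
      by unfold_locales (auto simp: complement_def)
    ultimately have "digraph_iso (with_proj G) (with_proj (complement S))"
      using f(1) by (auto simp: digraph_iso_with_proj_iff assms(6))
    then show False using assms(7) by (simp add: S_def m_def)
  qed
  have "\<exists>R' b z. R' \<subseteq> V - {r} \<and> card R' = card R \<and> b \<in> R' \<and> z \<in> R' \<and> b \<noteq> z
    \<and> top_eig V (parent_edges R p) \<le> top_eig V (dstar_edges R' r b z)
    \<and> (top_eig V (parent_edges R p) = top_eig V (dstar_edges R' r b z)
        \<longrightarrow> parent_edges R p = dstar_edges R' r b z)"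
    by (rule top_eig_le_dstar[OF finV r(1) R(1,3) acyc eq[unfolded R(4)] pos max _ nstar])
      (use R m in auto)
  then obtain R' b z where R': "R' \<subseteq> V - {r}" "card R' = m" "b \<in> R'" "z \<in> R'" "b \<noteq> z"
    and le: "top_eig V (parcs F) \<le> top_eig V (dstar_edges R' r b z)"
    and same: "top_eig V (parcs F) = top_eig V (dstar_edges R' r b z)
      \<Longrightarrow> parcs F = dstar_edges R' r b z"
    unfolding R(2,4) by blast
  note tD = top_D[OF r(1) R']
  have iso_iff: "digraph_iso (with_proj (complement G)) (with_proj D) \<longleftrightarrow>
      (\<exists>f. bij_betw f V (pverts D) \<and> parcs D = map_prod f f ` parcs F)"
    unfolding assms(6) complement_complement[OF F]
    using digraph_iso_with_proj_iff[OF F.pair_wf_digraph] by (simp add: V_def)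
  have "dist_spectral_radius G \<le> dist_spectral_radius (complement D)"
    using le tD rho_F rho_D by simp
  moreover have "dist_spectral_radius (complement D) < dist_spectral_radius (complement S)"
  proof -
    obtain R2 r2 where "r2 \<in> V" "R2 \<subseteq> V - {r2}" "card R2 = m"
      "top_eig V (dstar_edges R' r b z) < top_eig V (star_edges R2 r2)"
      using top_eig_dstar_less_star[OF finV r(1) R'(1,3-5)] m R'(2) by auto
    then show ?thesis using top_S tD rho_S rho_D by simp
  qed
  moreover have "dist_spectral_radius G = dist_spectral_radius (complement D) \<longleftrightarrow>
      digraph_iso (with_proj (complement G)) (with_proj D)"
  proof
    assume "dist_spectral_radius G = dist_spectral_radius (complement D)"
    then have "parcs F = dstar_edges R' r b z" using same tD rho_F rho_D by simp
    then show "digraph_iso (with_proj (complement G)) (with_proj D)"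
      unfolding iso_iff using dstar_on_V[OF r(1) R'] by simp
  next
    assume "digraph_iso (with_proj (complement G)) (with_proj D)"
    then obtain f where f: "bij_betw f V (pverts D)" "parcs D = map_prod f f ` parcs F"
      unfolding iso_iff by blast
    show "dist_spectral_radius G = dist_spectral_radius (complement D)"
      using top_eig_iso[OF f(1) FV.E_sub f(2)] rho_F rho_D by simp
  qed
  ultimately show ?thesis by (simp add: D_def S_def m_def)
qed

end
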